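(* Let $K$ be an algebraically closed field of characteristic zero and let $\delta=I-\phi$, where $\phi$ is an affine polynomial homomorphism of $K[x_1,x_2]$, i.e. $\phi$ is a $K$-algebra endomorphism with $(\phi(x_1),\phi(x_2))^t=A(x_1,x_2)^t+(c_1,c_2)^t$ for some $A\in \operatorname{M}_2(K)$ and $(c_1,c_2)^t\in K^2$. Then $\operatorname{Im}\delta$ is a Mathieu-Zhao space of $K[x_1,x_2]$.
   Context: $I$ is the identity map, and $\operatorname{Im}\delta=\delta(K[x_1,x_2])$. A $K$-subspace $M$ of $K[x_1,x_2]$ is a Mathieu-Zhao space of $K[x_1,x_2]$ if for any $a,b\in K[x_1,x_2]$ with $a^m\in M$ for all $m\geq 1$, one has $ba^m\in M$ for all sufficiently large $m$. *)

theory Defs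
  imports "HOL-Analysis.Cartesian_Space" "HOL-Computational_Algebra.Polynomial"
begin

text \<open>
  The polynomial ring \<open>K[x\<^sub>1,x\<^sub>2]\<close> is represented as \<open>K[x\<^sub>1][x\<^sub>2]\<close>, i.e. by the type
  \<open>'k poly poly\<close>: the inner variable is \<open>x\<^sub>1\<close>, the outer one is \<open>x\<^sub>2\<close>.
\<close>

definition const2 :: "'k::comm_ring_1 \<Rightarrow> 'k poly poly"
  where "const2 c = [:[:c:]:]"

definition X1 :: "'k::comm_ring_1 poly poly"
  where "X1 = [:[:0, 1:]:]"

definition X2 :: "'k::comm_ring_1 poly poly"
  where "X2 = [:0, 1:]"

definition scale2 :: "'k::comm_ring_1 \<Rightarrow> 'k poly poly \<Rightarrow> 'k poly poly"
  where "scale2 c p = const2 c * p"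

lemma vector_space_scale2: "vector_space (scale2 :: 'k::field \<Rightarrow> _)"
proof -
  have "const2 (a + b) = const2 a + const2 b" "const2 (a * b) = const2 a * const2 b"
    "const2 (1 :: 'k) = 1" for a b :: 'k
    by (simp_all add: const2_def one_pCons)
  then show ?thesis
    by unfold_locales (simp_all add: scale2_def algebra_simps)
qed

definition algebra_endomorphism :: "('k::comm_ring_1 poly poly \<Rightarrow> 'k poly poly) \<Rightarrow> bool"
  where "algebra_endomorphism \<phi> \<longleftrightarrow>
    module_hom scale2 scale2 \<phi> \<and> \<phi> 1 = 1 \<and> (\<forall>p q. \<phi> (p * q) = \<phi> p * \<phi> q)"

definition affine_polynomial_hom :: "('k::comm_ring_1 poly poly \<Rightarrow> 'k poly poly) \<Rightarrow> bool"
  where "affine_polynomial_hom \<phi> \<longleftrightarrow>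
    algebra_endomorphism \<phi> \<and>
    (\<exists>(A :: 'k^2^2) (c :: 'k^2).
      (vector [\<phi> X1, \<phi> X2] :: 'k poly poly^2) =
        map_matrix const2 A *v vector [X1, X2] + (\<chi> i. const2 (c $ i)))"

definition mathieu_zhao_space :: "'k::comm_ring_1 poly poly set \<Rightarrow> bool"
  where "mathieu_zhao_space M \<longleftrightarrow>
    module.subspace scale2 M \<and>
    (\<forall>a b. (\<forall>m\<ge>1. a ^ m \<in> M) \<longrightarrow> (\<forall>\<^sub>F m in sequentially. b * a ^ m \<in> M))"

end

theory Submission
  imports Defs "HOL-Computational_Algebra.Formal_Laurent_Series" "HOL-Computational_Algebra.Polynomial_FPS"
begin

text \<open>
  Over an algebraically closed field an affine endomorphism \<open>\<phi>\<close> becomes triangular in suitable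
  affine coordinates (an eigenvector of the matrix gives the first coordinate), and a further affine
  change brings it to one of three forms (\<open>mathieu_zhao_triangular\<close>). Conjugation by an
  automorphism transports the Mathieu-Zhao property (\<open>mathieu_zhao_conjugate\<close>), so each form can be
  treated by computing the image of \<open>I - \<phi>\<close>:

  \<^item> \<open>x\<^sub>1 \<mapsto> x\<^sub>1 + c\<close> with \<open>c \<noteq> 0\<close>: the map \<open>I - \<phi>\<close> is onto (\<open>im_diff_translation\<close>).

  \<^item> \<open>x\<^sub>1 \<mapsto> \<kappa> x\<^sub>1\<close>, \<open>x\<^sub>2 \<mapsto> \<kappa> x\<^sub>2 + x\<^sub>1\<close>: the image consists of the polynomials without the
    monomials \<open>x\<^sub>2\<^sup>b\<close> with \<open>\<kappa>\<^sup>b = 1\<close> (\<open>im_diff_jordan_block\<close>).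

  \<^item> \<open>x\<^sub>1 \<mapsto> \<kappa> x\<^sub>1\<close>, \<open>x\<^sub>2 \<mapsto> \<mu> x\<^sub>2\<close>: the image consists of the polynomials without resonant monomials,
    those \<open>x\<^sub>1\<^sup>a x\<^sub>2\<^sup>b\<close> with \<open>\<kappa>\<^sup>a \<mu>\<^sup>b = 1\<close> (\<open>im_diff_diagonal\<close>).

  In the last two cases no power \<open>f\<^sup>m\<close> with \<open>m \<ge> 1\<close> has a resonant monomial, and the same is wanted
  for \<open>g f\<^sup>m\<close> with \<open>m\<close> large. If the relevant eigenvalues are roots of unity, averaging over the
  finite group generated by the eigenvalues turns the hypothesis into the vanishing of all power sums of the values
  \<open>f(\<kappa>\<^sup>i x, \<mu>\<^sup>i y)\<close>, so these values vanish; if the resonances lie on one axis, this is applied to the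
  restriction of \<open>f\<close> to it. If only \<open>x\<^sub>1\<^sup>0 x\<^sub>2\<^sup>0\<close> is resonant, the image is a maximal ideal.

  The essential case is a resonance \<open>\<kappa>\<^sup>p \<mu>\<^sup>q = 1\<close> with \<open>p, q \<ge> 1\<close> between numbers that are not roots of
  unity. Every resonant monomial then has weight \<open>q a - p b = 0\<close>, and the claim is that all
  monomials of \<open>f\<close> have positive weight, or all have negative weight
  (\<open>definite_weight_of_no_resonance\<close>); the weights of \<open>g f\<^sup>m\<close> then move away from 0. Restricting \<open>f\<close> to the
  curves \<open>(\<kappa>\<^sup>i z\<^sup>q, \<mu>\<^sup>i y z\<^sup>-\<^sup>p)\<close> for \<open>i < p\<close> produces Laurent polynomials \<open>f\<^sub>i\<close> in \<open>z\<close> such that for every \<open>m \<ge> 1\<close>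
  the constant terms of the \<open>f\<^sub>i\<^sup>m\<close> add up to 0. A version of the
  theorem of Duistermaat and van der Kallen for finite families in one variable
  (\<open>constant_terms_of_powers_nonzero\<close>) excludes this unless the exponents of the \<open>f\<^sub>i\<close> all have the same strict sign.

  That theorem is proved as follows. Let \<open>f\<^sub>i\<close> have a pole of order \<open>r \<ge> 1\<close> at 0 and another one at
  infinity, and put \<open>s = X\<^sup>-\<^sup>r\<close>. The equation \<open>f\<^sub>i(x) = s\<close> has \<open>r\<close> solutions
  \<open>x\<close> in power series in \<open>X\<close> without constant term. By
  Lagrange inversion the logarithmic derivative of the product \<open>P\<close> of all these solutions, over all \<open>i\<close>, has the sums
  of constant terms, up to the factor \<open>r\<close>, as its coefficients, so their vanishing forces \<open>P\<close> to be a constant times a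
  positive power of \<open>1/s\<close>. But clearing denominators in \<open>f\<^sub>i(x) = s\<close> gives an equation whose leading
  coefficient in \<open>x\<close> is constant, so \<open>P\<close> is integral over \<open>K[s]\<close>, whereas no positive power of \<open>1/s\<close> is.
\<close>

unbundle no vec_syntax
unbundle fps_syntax

section \<open>Integral elements\<close>

text \<open>
  The identity matrix minus a matrix over \<open>I\<close> is invertible because its determinant lies in
  \<open>1 + I\<close> and hence is not 0. Elimination of one unknown at a time makes the determinant unnecessary;
  the factors \<open>u\<close> from \<open>1 + I\<close> absorb the denominators that it creates.
\<close>
lemma nonunital_nakayama:
  fixes v :: "'i \<Rightarrow> 'f::field" and I :: "'f set"
  assumes "finite J"
    and zero: "0 \<in> I" and one: "1 \<notin> I"
    and add: "\<And>x y. x \<in> I \<Longrightarrow> y \<in> I \<Longrightarrow> x + y \<in> I"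
    and uminus: "\<And>x. x \<in> I \<Longrightarrow> - x \<in> I"
    and mult: "\<And>x y. x \<in> I \<Longrightarrow> y \<in> I \<Longrightarrow> x * y \<in> I"
    and rel: "\<And>i. i \<in> J \<Longrightarrow> \<exists>u c. 1 - u \<in> I \<and> (\<forall>j\<in>J. c j \<in> I) \<and> u * v i = (\<Sum>j\<in>J. c j * v j)"
    and "i \<in> J"
  shows "v i = 0"
  using assms(1) rel assms(8)
proof (induction J arbitrary: i rule: finite_induct)
  case (insert k J)
  have diff: "x - y \<in> I" if "x \<in> I" "y \<in> I" for x y
    using add[OF that(1) uminus[OF that(2)]] by simp
  obtain u c where u: "1 - u \<in> I" "\<forall>j\<in>insert k J. c j \<in> I"
      "u * v k = (\<Sum>j\<in>insert k J. c j * v j)"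
    using insert.prems(1)[of k] by auto
  define w where "w = u - c k"
  have w: "1 - w \<in> I"
    using add[of "1 - u" "c k"] u(1,2) by (simp add: w_def algebra_simps)
  have wk: "w * v k = (\<Sum>j\<in>J. c j * v j)"
    using u(3) insert.hyps by (simp add: w_def algebra_simps)
  \<comment> \<open>Multiplying the relation for \<open>v i\<close> by \<open>w\<close> eliminates \<open>v k\<close>.\<close>
  have J0: "v i = 0" if "i \<in> J" for i
  proof (rule insert.IH[OF _ that])
    fix i assume i: "i \<in> J"
    obtain x d where x: "1 - x \<in> I" "\<forall>j\<in>insert k J. d j \<in> I"
        "x * v i = (\<Sum>j\<in>insert k J. d j * v j)"
      using insert.prems(1)[of i] i by auto
    have "(w * x) * v i = d k * (w * v k) + (\<Sum>j\<in>J. w * d j * v j)"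
      using x(3) insert.hyps by (simp add: algebra_simps sum_distrib_left)
    also have "\<dots> = (\<Sum>j\<in>J. (d k * c j + w * d j) * v j)"
      unfolding wk by (simp add: sum_distrib_left sum.distrib algebra_simps)
    finally have eq: "(w * x) * v i = (\<Sum>j\<in>J. (d k * c j + w * d j) * v j)" .
    have "1 - w * x = ((1 - w) + (1 - x)) - (1 - w) * (1 - x)"
      by (simp add: algebra_simps)
    then have "1 - w * x \<in> I"
      using diff[OF add[OF w x(1)] mult[OF w x(1)]] by metis
    moreover have "d k * c j + w * d j \<in> I" if "j \<in> J" for j
    proof -
      have "w * d j = d j - (1 - w) * d j" by (simp add: algebra_simps)
      then have "w * d j \<in> I"
        using diff[of "d j" "(1 - w) * d j"] mult[OF w, of "d j"] x(2) that by simp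
      then show ?thesis using add mult x(2) u(2) that by auto
    qed
    ultimately show "\<exists>u c. 1 - u \<in> I \<and> (\<forall>j\<in>J. c j \<in> I) \<and> u * v i = (\<Sum>j\<in>J. c j * v j)"
      using eq by (intro exI[of _ "w * x"] exI[of _ "\<lambda>j. d k * c j + w * d j"]) blast
  qed
  have "w \<noteq> 0" using w one by auto
  then have "v k = 0" using wk J0 by simp
  then show ?case using J0 insert.prems(2) by auto
qed simp

text \<open>
  A homomorphism \<open>h\<close> of commutative rings, with evaluation of polynomials at a point of its target.
  It is used for the coefficient embeddings into Laurent series and into \<open>K[x\<^sub>1,x\<^sub>2]\<close>, for evaluation
  in \<open>K\<close>, and, iterated, for polynomials in two variables.
\<close>
locale comm_ring_map =
  fixes h :: "'a::comm_ring_1 \<Rightarrow> 'b::comm_ring_1"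
  assumes hom_add: "h (a + b) = h a + h b"
    and hom_mult: "h (a * b) = h a * h b"
    and hom_one: "h 1 = 1"
begin

lemma hom_zero: "h 0 = 0"
  using hom_add[of 0 0] by simp

lemma hom_uminus: "h (- a) = - h a"
  using hom_add[of a "- a"] hom_zero by (simp add: eq_neg_iff_add_eq_0 add.commute)

lemma hom_diff: "h (a - b) = h a - h b"
  using hom_add[of a "- b"] by (simp add: hom_uminus)

lemma hom_power: "h (a ^ n) = h a ^ n"
  by (induction n) (simp_all add: hom_one hom_mult)

lemma hom_sum: "h (\<Sum>i\<in>A. f i) = (\<Sum>i\<in>A. h (f i))"
  by (induction A rule: infinite_finite_induct) (simp_all add: hom_zero hom_add)

definition ev :: "'b \<Rightarrow> 'a poly \<Rightarrow> 'b"
  where "ev x p = poly (map_poly h p) x"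

lemma ev_0: "ev x 0 = 0"
  by (simp add: ev_def)

lemma ev_pCons: "ev x (pCons a p) = h a + x * ev x p"
  by (simp add: ev_def map_poly_pCons hom_zero)

lemma ev_add: "ev x (p + q) = ev x p + ev x q"
  by (induction p q rule: poly_induct2) (simp_all add: ev_0 ev_pCons hom_add algebra_simps)

lemma ev_smult: "ev x (smult a p) = h a * ev x p"
  by (induction p) (simp_all add: ev_0 ev_pCons hom_mult algebra_simps)

lemma ev_mult: "ev x (p * q) = ev x p * ev x q"
  by (induction p) (simp_all add: ev_0 ev_pCons ev_add ev_smult hom_zero algebra_simps)

lemma ev_ring_map: "comm_ring_map (ev x)"
  by unfold_locales (simp_all add: ev_add ev_mult one_pCons ev_pCons ev_0 hom_one)

lemma ev_const: "ev x [:a:] = h a"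
  by (simp add: ev_pCons ev_0)

lemma ev_monom: "ev x (monom a n) = h a * x ^ n"
  by (induction n) (simp_all add: monom_0 monom_Suc ev_pCons ev_0 hom_zero algebra_simps)

lemma ev_sum_atMost:
  assumes "degree p \<le> n"
  shows "ev x p = (\<Sum>i\<le>n. h (coeff p i) * x ^ i)"
proof -
  interpret E: comm_ring_map "ev x" by (rule ev_ring_map)
  have "ev x p = ev x (\<Sum>i\<le>n. monom (coeff p i) i)"
    using poly_as_sum_of_monoms'[OF assms] by simp
  also have "\<dots> = (\<Sum>i\<le>n. h (coeff p i) * x ^ i)"
    by (simp add: E.hom_sum ev_monom)
  finally show ?thesis .
qed

end

locale field_valued_map = comm_ring_map h for h :: "'a::comm_ring_1 \<Rightarrow> 'f::field"
begin

sublocale mod: module "\<lambda>a v. h a * v"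
  by unfold_locales (simp_all add: hom_add hom_mult hom_one algebra_simps)

definition integral :: "'f \<Rightarrow> bool"
  where "integral y \<longleftrightarrow> (\<exists>n c. y ^ n = (\<Sum>j<n. h (c j) * y ^ j))"

lemma span_mult:
  assumes "\<And>g. g \<in> G \<Longrightarrow> z * g \<in> mod.span H" and "v \<in> mod.span G"
  shows "z * v \<in> mod.span H"
  using assms(2)
proof (induction rule: mod.span_induct_alt)
  case base
  then show ?case by (simp add: mod.span_zero)
next
  case (step c x y)
  have "z * (h c * x + y) = h c * (z * x) + z * y" by (simp add: algebra_simps)
  with step assms(1) show ?case
    by (simp add: mod.span_add mod.span_scale)
qed

text \<open>
  The products of powers below the degrees of the integral equations generate the module: a
  power that becomes too large is reduced by its own equation.
\<close>
lemma integral_elements_finite_module: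
  assumes "finite Y" and "\<And>y. y \<in> Y \<Longrightarrow> integral y"
  shows "\<exists>G. finite G \<and> 1 \<in> G \<and> (\<forall>y\<in>Y. \<forall>v\<in>mod.span G. y * v \<in> mod.span G)"
  using assms
proof (induction Y rule: finite_induct)
  case empty
  show ?case by (intro exI[of _ "{1}"]) simp
next
  case (insert y Y)
  then obtain G where G: "finite G" "1 \<in> G"
      "\<And>z v. z \<in> Y \<Longrightarrow> v \<in> mod.span G \<Longrightarrow> z * v \<in> mod.span G"
    by auto
  obtain n c where n: "y ^ n = (\<Sum>j<n. h (c j) * y ^ j)"
    using insert.prems[of y] by (auto simp: integral_def)
  define H where "H = (\<lambda>(g, j). g * y ^ j) ` (G \<times> {..<n})"
  have H: "g * y ^ j \<in> mod.span H" if "g \<in> G" "j < n" for g j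
    by (rule mod.span_base) (use that in \<open>force simp: H_def\<close>)
  have n0: "n > 0" using n by (cases n) auto
  have "finite H" using G(1) by (simp add: H_def)
  moreover have "1 \<in> H"
    using G(2) n0 by (force simp: H_def image_iff intro: bexI[of _ "(1, 0)"])
  moreover have "z * v \<in> mod.span H" if z: "z \<in> insert y Y" and v: "v \<in> mod.span H" for z v
    using _ v
  proof (rule span_mult)
    fix u assume "u \<in> H"
    then obtain g j where gj: "g \<in> G" "j < n" "u = g * y ^ j" by (auto simp: H_def)
    show "z * u \<in> mod.span H"
    proof (cases "z = y")
      case True
      show ?thesis
      proof (cases "Suc j < n")
        case True
        then show ?thesis using H[OF gj(1) True] \<open>z = y\<close> gj(3) by (simp add: algebra_simps)
      next
        case False
        then have "n = Suc j" using gj(2) by simp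
        then have "z * u = g * y ^ n" using \<open>z = y\<close> gj(3) by (simp add: algebra_simps)
        also have "\<dots> = (\<Sum>k<n. h (c k) * (g * y ^ k))"
          by (simp add: n sum_distrib_left algebra_simps)
        also have "\<dots> \<in> mod.span H"
          by (intro mod.span_sum mod.span_scale H gj) simp
        finally show ?thesis .
      qed
    next
      case False
      then have "z * g \<in> mod.span G"
        using z G(3) mod.span_base[OF gj(1)] by auto
      then have "y ^ j * (z * g) \<in> mod.span H"
        by (rule span_mult[rotated]) (use H gj(2) in \<open>simp add: algebra_simps\<close>)
      then show ?thesis by (simp add: gj(3) algebra_simps)
    qed
  qed
  ultimately show ?case by blast
qed

text \<open>
  If the product \<open>P\<close> is the inverse of \<open>h b\<close>, the module \<open>M\<close> that the factors \<open>y i\<close> preserve satisfies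
  \<open>M = h b P M \<subseteq> h b M\<close>. Unless \<open>h b\<close> is a unit in the range of \<open>h\<close>, Nakayama's lemma gives
  \<open>M = 0\<close>, although \<open>M\<close> contains 1.
\<close>
lemma inverse_of_integral_product:
  assumes "finite S" and int: "\<And>i. i \<in> S \<Longrightarrow> integral (y i)"
    and inv: "(\<Prod>i\<in>S. y i) * h b = 1"
  shows "\<exists>a. h (b * a) = 1"
proof (rule ccontr)
  assume contra: "\<nexists>a. h (b * a) = 1"
  obtain G where G: "finite G" "1 \<in> G"
      "\<And>z v. z \<in> y ` S \<Longrightarrow> v \<in> mod.span G \<Longrightarrow> z * v \<in> mod.span G"
    using integral_elements_finite_module[of "y ` S"] assms(1) int by (metis finite_imageI imageE)
  have prod: "(\<Prod>i\<in>T. y i) * v \<in> mod.span G" if "finite T" "T \<subseteq> S" "v \<in> mod.span G" for T v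
    using that
    by (induction T rule: finite_induct) (auto simp: mult.assoc intro!: G(3))
  define I where "I = range (\<lambda>a. h (b * a))"
  have "(1 :: 'f) = 0"
  proof (rule nonunital_nakayama[OF G(1), where I = I and v = "\<lambda>g. g" and i = 1])
    show "0 \<in> I" by (auto simp: I_def image_iff hom_zero intro!: exI[of _ 0])
    show "1 \<notin> I" using contra by (auto simp: I_def)
    show "1 \<in> G" by (rule G(2))
    show "x + z \<in> I" if "x \<in> I" "z \<in> I" for x z
      using that by (auto simp: I_def simp flip: hom_add distrib_left)
    show "- x \<in> I" if "x \<in> I" for x
      using that by (auto simp: I_def simp flip: hom_uminus mult_minus_right)
    show "x * z \<in> I" if "x \<in> I" "z \<in> I" for x z
      using that by (auto simp: I_def mult.assoc simp flip: hom_mult)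
    fix g assume "g \<in> G"
    then have "(\<Prod>i\<in>S. y i) * g \<in> mod.span G"
      using prod[OF assms(1)] mod.span_base by blast
    then obtain u where u: "(\<Prod>i\<in>S. y i) * g = (\<Sum>j\<in>G. h (u j) * j)"
      using mod.span_finite[OF G(1)] by auto
    have "g = ((\<Prod>i\<in>S. y i) * h b) * g" by (simp add: inv)
    also have "\<dots> = h b * ((\<Prod>i\<in>S. y i) * g)" by (simp add: algebra_simps)
    also have "\<dots> = (\<Sum>j\<in>G. h (b * u j) * j)"
      unfolding u by (simp add: sum_distrib_left hom_mult algebra_simps)
    finally have "1 * g = (\<Sum>j\<in>G. h (b * u j) * j)" by simp
    then show "\<exists>x c. 1 - x \<in> I \<and> (\<forall>j\<in>G. c j \<in> I) \<and> x * g = (\<Sum>j\<in>G. c j * j)"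
      by (intro exI[of _ 1] exI[of _ "\<lambda>j. h (b * u j)"]) (auto simp: I_def image_iff hom_zero intro: exI[of _ 0])
  qed
  then show False by simp
qed

end

section \<open>Power sums and roots of unity\<close>

text \<open>
  The hypothesis says that the values of every polynomial without constant term add up to 0. If
  \<open>a i \<noteq> 0\<close>, apply this to a polynomial that vanishes at 0 and at all the other values of \<open>a\<close>: what
  remains is a positive multiple of its value at \<open>a i\<close>.
\<close>
lemma power_sums_eq_0_imp_eq_0:
  fixes a :: "'i \<Rightarrow> 'k::field_char_0"
  assumes fin: "finite I" and sums: "\<And>m. m \<ge> 1 \<Longrightarrow> (\<Sum>i\<in>I. a i ^ m) = 0" and "i \<in> I"
  shows "a i = 0"
proof (rule ccontr)
  assume nz: "a i \<noteq> 0"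
  define q where "q = [:0, 1:] * (\<Prod>w\<in>a ` I - {a i}. [:- w, 1:])"
  have "(\<Sum>j\<in>I. poly q (a j)) = (\<Sum>j\<in>I. \<Sum>k\<le>degree q. coeff q k * a j ^ k)"
    by (simp add: poly_altdef)
  also have "\<dots> = (\<Sum>k\<le>degree q. coeff q k * (\<Sum>j\<in>I. a j ^ k))"
    by (subst sum.swap) (simp add: sum_distrib_left)
  also have "\<dots> = 0"
  proof (intro sum.neutral ballI)
    fix k show "coeff q k * (\<Sum>j\<in>I. a j ^ k) = 0"
      using sums[of k] by (cases k) (simp_all add: q_def)
  qed
  finally have "(\<Sum>j\<in>I. poly q (a j)) = 0" .
  moreover have "(\<Sum>j\<in>I. poly q (a j)) = (\<Sum>j\<in>{j\<in>I. a j = a i}. poly q (a i))"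
    using fin by (intro sum.mono_neutral_cong_right) (auto simp: q_def poly_prod)
  moreover have "poly q (a i) \<noteq> 0"
    using nz fin by (auto simp: q_def poly_prod)
  moreover have "card {j\<in>I. a j = a i} \<noteq> 0"
    using fin assms(3) by (auto simp: card_eq_0_iff)
  ultimately show False by simp
qed

lemma roots_of_unity_as_roots:
  "{w. w ^ r = (1::'k::comm_ring_1)} = {w. poly (monom 1 r - 1) w = 0}"
  by (simp add: poly_monom)

lemma monom_minus_one:
  assumes "r \<ge> 1"
  shows "degree (monom 1 r - 1 :: 'k::comm_ring_1 poly) = r" "(monom 1 r - 1 :: 'k poly) \<noteq> 0"
proof -
  have "degree (monom 1 r + (- 1) :: 'k poly) = r"
    using assms by (subst degree_add_eq_left) (simp_all add: degree_monom_eq)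
  then show *: "degree (monom 1 r - 1 :: 'k poly) = r" by simp
  then show "(monom 1 r - 1 :: 'k poly) \<noteq> 0" using assms by auto
qed

lemma card_roots_of_unity_le:
  assumes "r \<ge> 1"
  shows "finite {w. w ^ r = (1::'k::idom)}" "card {w. w ^ r = (1::'k)} \<le> r"
  unfolding roots_of_unity_as_roots
  subgoal by (rule poly_roots_finite[OF monom_minus_one(2)[OF assms]])
  subgoal by (rule order_trans[OF card_poly_roots_bound[OF monom_minus_one(2)[OF assms]]])
    (rule eq_refl[OF monom_minus_one(1)[OF assms]])
  done

lemma card_roots_of_unity:
  assumes "r \<ge> 1"
  shows "card {w. w ^ r = (1::'k::{alg_closed_field,field_char_0})} = r"
proof -
  define p where "p = (monom 1 r - 1 :: 'k poly)"
  have p: "degree p = r" "p \<noteq> 0" unfolding p_def by (rule monom_minus_one[OF assms])+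
  have "rsquarefree p"
    unfolding rsquarefree_roots
  proof (intro allI notI, elim conjE)
    fix a assume "poly p a = 0" "poly (pderiv p) a = 0"
    then have "a ^ r = 1" "of_nat r * a ^ (r - 1) = 0"
      by (simp_all add: p_def poly_monom pderiv_diff pderiv_monom)
    moreover have "(of_nat r :: 'k) \<noteq> 0" using assms by simp
    ultimately have "a ^ r = 1" "a = 0" by simp_all
    then show False using assms by (simp add: power_0_left)
  qed
  obtain A where A: "size A = r" "p = smult (lead_coeff p) (\<Prod>x\<in>#A. [:-x, 1:])"
    using alg_closed_imp_factorization[OF p(2)] p(1) by auto
  have "proots p = proots (\<Prod>x\<in>#A. [:-x, 1:])"
    by (subst A(2), rule proots_smult) (use p(2) in simp)
  also have "\<dots> = A"
  proof (induction A)
    case (add x A)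
    have "(\<Prod>x\<in>#A. [:-x, 1:]) \<noteq> 0" by (auto simp: prod_mset_zero_iff)
    then show ?case using add proots_mult[of "[:-x, 1:]" "\<Prod>x\<in>#A. [:-x, 1:]"]
      by (simp del: mult_pCons_left)
  qed simp
  finally have "size (proots p) = r" using A(1) by simp
  moreover have "size (proots p) = (\<Sum>x\<in>{x. poly p x = 0}. order x p)"
    using p(2) by (simp add: size_multiset_overloaded_eq)
  moreover have "\<dots> = (\<Sum>x\<in>{x. poly p x = 0}. 1)"
    using rsquarefree_root_order[OF \<open>rsquarefree p\<close> _ p(2)] by (intro sum.cong) auto
  ultimately show ?thesis by (simp add: roots_of_unity_as_roots p_def)
qed

text \<open>
  If \<open>r\<close> does not divide \<open>n\<close>, some \<open>r\<close>-th root of unity \<open>u\<close> has \<open>u ^ n \<noteq> 1\<close>, since otherwise all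
  \<open>r\<close> of them would be roots of unity of the smaller order \<open>gcd n r\<close>.
\<close>
lemma sum_roots_of_unity_power:
  assumes "r \<ge> 1"
  shows "(\<Sum>w | w ^ r = (1::'k::{alg_closed_field,field_char_0}). w ^ n)
    = (if r dvd n then of_nat r else 0)"
proof (cases "r dvd n")
  case True
  then have "(\<Sum>w | w ^ r = (1::'k). w ^ n) = (\<Sum>w | w ^ r = (1::'k). 1)"
    by (intro sum.cong) (auto simp: power_mult elim!: dvdE)
  then show ?thesis using True by (simp add: card_roots_of_unity[OF assms])
next
  case False
  define R where "R = {w. w ^ r = (1::'k)}"
  have "n \<noteq> 0" using False by (rule contrapos_nn) simp
  then obtain d x y where d: "d dvd n" "d dvd r" "n * x = r * y + d"
    using bezout_add_strong_nat by blast
  have "d \<noteq> r" using d(1) False by blast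
  moreover have "d \<noteq> 0" using d(2) assms by (metis dvd_0_left_iff not_one_le_zero)
  moreover have "d \<le> r" using d(2) assms by (simp add: dvd_imp_le)
  ultimately have "d < r" "d \<ge> 1" by simp_all
  have "\<not> R \<subseteq> {w. w ^ d = 1}"
  proof
    assume "R \<subseteq> {w. w ^ d = 1}"
    then have "r \<le> card {w. w ^ d = (1::'k)}"
      using card_mono[of "{w. w ^ d = (1::'k)}" R] card_roots_of_unity_le[OF \<open>d \<ge> 1\<close>, where ?'k = 'k]
        card_roots_of_unity[OF assms, where ?'k = 'k]
      by (simp add: R_def)
    then show False using card_roots_of_unity_le(2)[OF \<open>d \<ge> 1\<close>, where ?'k = 'k] \<open>d < r\<close> by simp
  qed
  then obtain u where u: "u \<in> R" "u ^ d \<noteq> 1" by auto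
  have un: "u ^ n \<noteq> 1"
  proof
    assume "u ^ n = 1"
    then have "1 = u ^ (n * x)" by (simp add: power_mult)
    also have "\<dots> = u ^ d" using u(1) unfolding d(3) by (simp add: power_add power_mult R_def)
    finally show False using u(2) by simp
  qed
  have u0: "u \<noteq> 0" using u(1) assms by (auto simp: R_def power_0_left)
  \<comment> \<open>Multiplication by \<open>u\<close> permutes the roots of unity, so the factor \<open>u ^ n \<noteq> 1\<close> leaves the sum unchanged.\<close>
  have "(\<Sum>w\<in>R. w ^ n) = (\<Sum>w\<in>R. (u * w) ^ n)"
    by (rule sum.reindex_bij_witness[of _ "\<lambda>w. u * w" "\<lambda>w. w / u"])
      (use u(1) u0 in \<open>auto simp: R_def power_mult_distrib power_divide\<close>)
  also have "\<dots> = u ^ n * (\<Sum>w\<in>R. w ^ n)"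
    by (simp add: power_mult_distrib sum_distrib_left)
  finally have "(\<Sum>w\<in>R. w ^ n) = 0" using un by auto
  then show ?thesis using False by (simp add: R_def)
qed

section \<open>Constant terms of powers of Laurent polynomials\<close>

text \<open>
  A local solution \<open>x = \<chi>(X)\<close> of \<open>g(x) / x\<^sup>r = X\<^sup>-\<^sup>r\<close>: with an \<open>r\<close>-th root \<open>u\<close> of \<open>g\<close>, the equation
  becomes \<open>x / u(x) = X\<close>, which is solved by the compositional inverse.
\<close>
lemma branch_exists:
  fixes g :: "'k::{alg_closed_field,field_char_0} fps"
  assumes "r \<ge> 1" "g $ 0 \<noteq> 0"
  obtains \<chi> where "\<chi> $ 0 = 0" "\<chi> $ 1 \<noteq> 0" "fps_X ^ r * (g oo \<chi>) = \<chi> ^ r"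
proof -
  obtain k where r: "r = Suc k" using assms(1) by (cases r) auto
  obtain b where b: "b ^ r = g $ 0" using nth_root_exists[of r "g $ 0"] assms(1) by auto
  define u where "u = fps_radical (\<lambda>_ _. b) r g"
  have u: "u ^ r = g"
    using power_radical[of g "\<lambda>_ _. b" k] assms(2) b by (simp add: u_def r)
  have u0: "u $ 0 \<noteq> 0"
    using b assms by (auto simp: u_def r)
  define \<psi> where "\<psi> = fps_X * inverse u"
  have \<psi>: "\<psi> $ 0 = 0" "\<psi> $ 1 \<noteq> 0" using u0 by (simp_all add: \<psi>_def fps_mult_nth)
  define \<chi> where "\<chi> = fps_inv \<psi>"
  have \<chi>0: "\<chi> $ 0 = 0" by (simp add: \<chi>_def fps_inv_def)
  have comp: "\<psi> oo \<chi> = fps_X" unfolding \<chi>_def by (rule fps_inv_right[OF \<psi>])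
  have "\<psi> * u = fps_X"
    using u0 by (simp add: \<psi>_def mult.assoc inverse_mult_eq_1)
  then have "(\<psi> * u) oo \<chi> = fps_X oo \<chi>" by simp
  then have eq: "fps_X * (u oo \<chi>) = \<chi>"
    by (simp add: fps_compose_mult_distrib[OF \<chi>0] comp \<chi>0)
  have "\<chi> ^ r = fps_X ^ r * (u oo \<chi>) ^ r"
    by (subst eq[symmetric]) (simp add: power_mult_distrib)
  also have "(u oo \<chi>) ^ r = g oo \<chi>"
    by (simp add: fps_compose_power[OF \<chi>0] u)
  finally have "fps_X ^ r * (g oo \<chi>) = \<chi> ^ r" by simp
  moreover have "\<chi> $ 1 \<noteq> 0"
    using \<psi> by (simp add: \<chi>_def fps_inv_def)
  ultimately show ?thesis using that \<chi>0 by blast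
qed

lemma residue_power_times_deriv:
  fixes F :: "'k::field_char_0 fls"
  shows "fls_residue (F ^ n * fls_deriv F) = 0"
proof -
  have "fls_deriv (F ^ Suc n) = of_nat (Suc n) * (F ^ n * fls_deriv F)"
    by (simp only: fls_deriv_power diff_Suc_1 mult.assoc)
  then have "of_nat (Suc n) * fls_residue (F ^ n * fls_deriv F) = 0"
    using fls_residue_deriv[of "F ^ Suc n"] by (simp only: fls_residue_def fls_mult_of_nat_nth)
  then show ?thesis by (simp only: mult_eq_0_iff of_nat_eq_0_iff) simp
qed

lemma residue_inverse_power_times_deriv:
  fixes F :: "'k::field_char_0 fls"
  assumes "F \<noteq> 0"
  shows "fls_residue (inverse F ^ (n + 2) * fls_deriv F) = 0"
proof -
  define D where "D = inverse F"
  have "F * D = 1" using assms by (simp add: D_def)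
  then have "fls_deriv (F * D) = 0" by simp
  then have "D * (F * fls_deriv D + fls_deriv F * D) = 0" by simp
  then have "(F * D) * fls_deriv D = - (D ^ 2 * fls_deriv F)"
    by (simp add: algebra_simps power2_eq_square eq_neg_iff_add_eq_0)
  then have "fls_deriv D = - (D ^ 2 * fls_deriv F)" by (simp add: \<open>F * D = 1\<close>)
  then have "D ^ n * fls_deriv D = - (D ^ (n + 2) * fls_deriv F)"
    by (simp only: power_add mult_minus_right mult.assoc)
  then show ?thesis
    using residue_power_times_deriv[of D n] by (simp add: D_def)
qed

lemma fps_to_fls_sum: "fps_to_fls (\<Sum>i\<in>A. f i) = (\<Sum>i\<in>A. fps_to_fls (f i))"
  by (induction A rule: infinite_finite_induct) simp_all

text \<open>
  The coefficient of \<open>X\<^sup>r\<^sup>m\<close> in \<open>\<beta> = X \<chi>' / \<chi>\<close> is the residue of \<open>X\<^sup>-\<^sup>r\<^sup>m d\<chi> / \<chi>\<close>. Since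
  \<open>X\<^sup>-\<^sup>r = g(\<chi>) / \<chi>\<^sup>r\<close>, this is the residue of \<open>(g(x) / x\<^sup>r)\<^sup>m dx / x\<close> written in the parameter
  \<open>x = \<chi>\<close>, that is, the constant term of the \<open>m\<close>-th power of the Laurent polynomial \<open>g(x) / x\<^sup>r\<close>.
\<close>
lemma lagrange_log_derivative:
  fixes g :: "'k::field_char_0 poly"
  assumes \<chi>: "\<chi> $ 0 = 0" "\<chi> $ 1 \<noteq> 0"
    and eq: "fps_X ^ r * (fps_of_poly g oo \<chi>) = \<chi> ^ r"
    and \<beta>: "fps_X * fps_deriv \<chi> = \<chi> * \<beta>"
  shows "\<beta> $ (r * m) = coeff (g ^ m) (r * m)"
proof -
  define M G where "M = r * m" and "G = g ^ m"
  define F B where "F = fps_to_fls \<chi>" and "B = fps_to_fls \<beta>"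
  have nz: "F \<noteq> 0" using \<chi>(2) by (auto simp: F_def)
  have eqM: "fps_X ^ M * (fps_of_poly G oo \<chi>) = \<chi> ^ M"
  proof -
    have "(fps_X ^ r * (fps_of_poly g oo \<chi>)) ^ m = (\<chi> ^ r) ^ m" by (simp add: eq)
    then show ?thesis
      by (simp add: M_def G_def power_mult power_mult_distrib fps_compose_power[OF \<chi>(1)] fps_of_poly_power)
  qed
  have Gsum: "fps_of_poly G oo \<chi> = (\<Sum>k\<le>degree G. fps_const (coeff G k) * \<chi> ^ k)"
  proof -
    have "fps_of_poly G = fps_of_poly (\<Sum>k\<le>degree G. monom (coeff G k) k)"
      by (simp add: poly_as_sum_of_monoms)
    also have "\<dots> = (\<Sum>k\<le>degree G. fps_const (coeff G k) * fps_X ^ k)"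
      by (simp add: fps_of_poly_sum fps_of_poly_monom)
    also have "\<dots> oo \<chi> = (\<Sum>k\<le>degree G. fps_const (coeff G k) * \<chi> ^ k)"
      by (simp add: fps_compose_sum_distrib fps_compose_mult_distrib[OF \<chi>(1)] \<chi>(1)
        fps_compose_power[OF \<chi>(1), symmetric])
    finally show ?thesis .
  qed
  have XF: "fls_X * fls_deriv F = F * B"
    using arg_cong[OF \<beta>, of fps_to_fls]
    by (simp only: F_def B_def fls_deriv_fps_to_fls fls_times_fps_to_fls fps_X_to_fls)
  have inv: "F ^ j * inverse F ^ j = 1" for j
    using nz by (simp flip: power_mult_distrib)
  define S where "S = (\<Sum>k\<le>degree G. fls_const (coeff G k) * F ^ k)"
  have S: "fls_X ^ M * S = F ^ M"
  proof -
    have "fps_to_fls (fps_X ^ M * (fps_of_poly G oo \<chi>)) = fls_X ^ M * S"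
      by (simp only: Gsum S_def fls_times_fps_to_fls fps_to_fls_power fps_to_fls_sum
        fps_X_to_fls fps_const_to_fls F_def)
    then show ?thesis by (simp only: eqM fps_to_fls_power F_def)
  qed
  \<comment> \<open>The coefficient of \<open>\<beta>\<close> at \<open>M\<close> is the residue of \<open>S * F' / F\<^sup>M\<^sup>+\<^sup>1\<close>, to which only one term of \<open>S\<close> contributes.\<close>
  have "fls_X ^ Suc M * (S * inverse F ^ Suc M * fls_deriv F)
      = (fls_X ^ M * S) * inverse F ^ Suc M * (fls_X * fls_deriv F)"
    by (simp add: algebra_simps)
  also have "\<dots> = B"
    unfolding S XF using nz by (simp add: power_inverse field_simps)
  finally have "B = fls_X ^ Suc M * (S * inverse F ^ Suc M * fls_deriv F)" by simp
  then have "B $$ int M = fls_residue (S * inverse F ^ Suc M * fls_deriv F)"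
    by (simp add: fls_X_power_times_conv_shift del: power_Suc)
  also have "S * inverse F ^ Suc M * fls_deriv F
      = (\<Sum>k\<le>degree G. fls_const (coeff G k) * (F ^ k * inverse F ^ Suc M * fls_deriv F))"
    by (simp add: S_def sum_distrib_right sum_distrib_left mult_ac del: power_Suc)
  also have "fls_residue \<dots> = (\<Sum>k\<le>degree G. if k = M then coeff G k else 0)"
  proof -
    have res: "fls_residue (F ^ k * inverse F ^ Suc M * fls_deriv F) = (if k = M then 1 else 0)" for k
    proof (cases k M rule: linorder_cases)
      case less
      then obtain n where n: "M = k + Suc n" using less_imp_Suc_add by auto
      then have "Suc M = k + (n + 2)" by simp
      then have "F ^ k * inverse F ^ Suc M = inverse F ^ (n + 2)"
        by (simp only: power_add mult.assoc[symmetric] inv mult_1_left)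
      then show ?thesis
        using residue_inverse_power_times_deriv[OF nz, of n] less by (simp only:) simp
    next
      case equal
      then have "F ^ k * inverse F ^ Suc M * fls_deriv F = inverse F * fls_deriv F"
        using inv[of M] by (simp add: mult.left_commute[of "F ^ M"])
      also have "\<dots> = fls_shift 1 B"
      proof -
        have "inverse F * (fls_X * fls_deriv F) = B" unfolding XF using nz by simp
        then have "B = fls_X * (inverse F * fls_deriv F)" by (simp add: algebra_simps)
        then show ?thesis by (simp add: fls_X_times_conv_shift)
      qed
      finally have "fls_residue (F ^ k * inverse F ^ Suc M * fls_deriv F) = \<beta> $ 0"
        by (simp add: B_def)
      moreover have "(fps_X * fps_deriv \<chi>) $ 1 = (\<chi> * \<beta>) $ 1" by (simp add: \<beta>)
      then have "\<beta> $ 0 = 1" using \<chi> by (simp add: fps_mult_nth)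
      ultimately show ?thesis using equal by simp
    next
      case greater
      then obtain n where n: "k = M + Suc n" using less_imp_Suc_add by auto
      then have "k = n + Suc M" by simp
      then have "F ^ k * inverse F ^ Suc M = F ^ n"
        by (simp only: power_add mult.assoc inv mult_1_right)
      then show ?thesis using residue_power_times_deriv[of F n] greater by (simp only:) simp
    qed
    define T where "T k = F ^ k * inverse F ^ Suc M * fls_deriv F" for k
    have T: "T k $$ -1 = (if k = M then 1 else 0)" for k
      using res[of k] by (simp only: T_def fls_residue_def)
    show ?thesis
      unfolding T_def[symmetric] by (simp add: fls_nth_sum T if_distrib cong: if_cong)
  qed
  also have "\<dots> = coeff G M"
    by (auto simp: coeff_eq_0)
  finally have "B $$ int M = coeff G M" .
  moreover have "B $$ int M = \<beta> $ M" by (simp add: B_def)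
  ultimately show ?thesis by (simp add: M_def[symmetric] G_def[symmetric])
qed

lemma log_derivative_prod:
  fixes f h :: "'i \<Rightarrow> 'k::comm_ring_1 fps"
  assumes "finite S" and "\<And>i. i \<in> S \<Longrightarrow> fps_X * fps_deriv (f i) = f i * h i"
  shows "fps_X * fps_deriv (\<Prod>i\<in>S. f i) = (\<Prod>i\<in>S. f i) * (\<Sum>i\<in>S. h i)"
  using assms
proof (induction S rule: finite_induct)
  case (insert i S)
  have "fps_X * fps_deriv (\<Prod>j\<in>insert i S. f j)
      = f i * (fps_X * fps_deriv (\<Prod>j\<in>S. f j)) + (fps_X * fps_deriv (f i)) * (\<Prod>j\<in>S. f j)"
    using insert.hyps by (simp add: algebra_simps)
  also have "\<dots> = (\<Prod>j\<in>insert i S. f j) * (\<Sum>j\<in>insert i S. h j)"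
    using insert by (simp add: algebra_simps)
  finally show ?case .
qed simp

lemma constant_log_derivative_imp_monomial:
  fixes P :: "'k::field_char_0 fps"
  assumes "fps_X * fps_deriv P = P * of_nat N"
  shows "P = fps_const (P $ N) * fps_X ^ N"
proof (rule fps_ext)
  fix n
  have "(fps_X * fps_deriv P) $ n = of_nat n * P $ n"
    by (cases n) simp_all
  moreover have "(P * of_nat N) $ n = of_nat N * P $ n"
    by (metis fps_mult_of_nat_nth(2) mult.commute)
  ultimately have "of_nat n * P $ n = of_nat N * P $ n" using assms by metis
  then have "P $ n = 0 \<or> n = N" by (metis mult_cancel_right of_nat_eq_iff)
  then show "P $ n = (fps_const (P $ N) * fps_X ^ N) $ n"
    by (cases "n = N") (simp_all add: fps_X_power_iff)
qed

lemma log_derivative_scale: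
  fixes f h :: "'k::idom fps"
  assumes "fps_X * fps_deriv f = f * h"
  shows "fps_X * fps_deriv (f oo (fps_const w * fps_X))
    = (f oo (fps_const w * fps_X)) * (h oo (fps_const w * fps_X))"
proof -
  define l where "l = fps_const w * fps_X"
  have l0: "l $ 0 = 0" by (simp add: l_def)
  have "fps_X * fps_deriv (f oo l) = (fps_X oo l) * (fps_deriv f oo l)"
    by (simp add: fps_compose_deriv[OF l0] l0) (simp add: l_def algebra_simps)
  also have "\<dots> = (f oo l) * (h oo l)"
    by (simp only: fps_compose_mult_distrib[OF l0, symmetric] assms)
  finally show ?thesis by (simp add: l_def)
qed

interpretation FL: comm_ring_map "fls_const :: 'k::comm_ring_1 \<Rightarrow> 'k fls"
  by unfold_locales (simp_all add: fls_plus_const)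

text \<open>
  For a root of unity \<open>w\<close> of order dividing \<open>r\<close>, the series \<open>\<chi>(w X)\<close> solves the same equation as \<open>\<chi>\<close>,
  and summation over all \<open>w\<close> keeps exactly the exponents divisible by \<open>r\<close> in the logarithmic
  derivative. The assumption \<open>degree (g i) > r\<close> says that \<open>g i / x\<^sup>r\<close> has a pole at infinity; it makes
  the leading coefficient of \<open>g i - s x\<^sup>r\<close> a constant, which is what integrality over \<open>K[s]\<close> needs.
\<close>
lemma two_sided_constant_terms_contradiction:
  fixes g :: "'i \<Rightarrow> 'k::{alg_closed_field,field_char_0} poly"
  assumes fin: "finite I" "I \<noteq> {}" and r: "r \<ge> 1"
    and g0: "\<And>i. i \<in> I \<Longrightarrow> coeff (g i) 0 \<noteq> 0"
    and deg: "\<And>i. i \<in> I \<Longrightarrow> degree (g i) > r"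
    and vanish: "\<And>m. m \<ge> 1 \<Longrightarrow> (\<Sum>i\<in>I. coeff (g i ^ m) (r * m)) = 0"
  shows False
proof -
  have "\<exists>\<chi> \<beta>. \<chi> $ 0 = 0 \<and> \<chi> $ 1 \<noteq> 0 \<and> fps_X ^ r * (fps_of_poly (g i) oo \<chi>) = \<chi> ^ r \<and>
      fps_X * fps_deriv \<chi> = \<chi> * \<beta>" if i: "i \<in> I" for i
  proof -
    obtain \<chi> where \<chi>: "\<chi> $ 0 = 0" "\<chi> $ 1 \<noteq> 0" "fps_X ^ r * (fps_of_poly (g i) oo \<chi>) = \<chi> ^ r"
      using branch_exists[OF r, of "fps_of_poly (g i)"] g0[OF i] by auto
    define \<kappa> where "\<kappa> = fps_shift 1 \<chi>"
    have \<kappa>: "\<chi> = fps_X * \<kappa>" by (rule fps_ext) (use \<chi>(1) in \<open>auto simp: \<kappa>_def\<close>)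
    have "\<kappa> $ 0 \<noteq> 0" using \<chi>(2) by (simp add: \<kappa>_def)
    then have "\<kappa> * inverse \<kappa> = 1" by (rule inverse_mult_eq_1')
    then have "fps_X * fps_deriv \<chi> = (fps_X * \<kappa>) * (inverse \<kappa> * fps_deriv \<chi>)"
      by (metis mult.assoc mult_1_left)
    then have "fps_X * fps_deriv \<chi> = \<chi> * (inverse \<kappa> * fps_deriv \<chi>)"
      by (simp only: \<kappa>[symmetric])
    then show ?thesis using \<chi> by blast
  qed
  then obtain \<chi> \<beta> where \<chi>: "\<chi> i $ 0 = 0" "\<chi> i $ 1 \<noteq> 0"
      "fps_X ^ r * (fps_of_poly (g i) oo \<chi> i) = \<chi> i ^ r"
      and \<beta>: "fps_X * fps_deriv (\<chi> i) = \<chi> i * \<beta> i" if "i \<in> I" for i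
    by metis
  define R where "R = {w. w ^ r = (1::'k)}"
  have R: "finite R" "0 \<notin> R" using card_roots_of_unity_le(1)[OF r] r by (auto simp: R_def power_0_left)
  define l where "l = (\<lambda>w::'k. fps_const w * fps_X)"
  have l0: "l w $ 0 = 0" for w by (simp add: l_def)
  define x where "x = (\<lambda>(i, w). \<chi> i oo l w)"
  define P where "P = (\<Prod>p\<in>I \<times> R. x p)"
  have finS: "finite (I \<times> R)" using fin R by simp
  have "fps_X * fps_deriv P = P * (\<Sum>(i, w)\<in>I \<times> R. \<beta> i oo l w)"
    unfolding P_def x_def case_prod_unfold
    by (rule log_derivative_prod[OF finS]) (auto simp: l_def intro!: log_derivative_scale \<beta>)
  also have "(\<Sum>(i, w)\<in>I \<times> R. \<beta> i oo l w) = of_nat (r * card I)"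
  proof (rule fps_ext)
    fix n
    have "(\<Sum>(i, w)\<in>I \<times> R. \<beta> i oo l w) $ n = (\<Sum>i\<in>I. \<Sum>w\<in>R. w ^ n * \<beta> i $ n)"
      by (simp add: fps_sum_nth sum.cartesian_product case_prod_unfold l_def fps_compose_linear)
    also have "\<dots> = (\<Sum>w\<in>R. w ^ n) * (\<Sum>i\<in>I. \<beta> i $ n)"
      by (simp add: sum_product sum.swap[of _ R I])
    also have "\<dots> = (if r dvd n then of_nat r * (\<Sum>i\<in>I. \<beta> i $ n) else 0)"
      unfolding R_def by (simp add: sum_roots_of_unity_power[OF r])
    also have "\<dots> = of_nat (r * card I) $ n"
    proof (cases "r dvd n")
      case True
      then obtain m where m: "n = r * m" by auto
      have "(\<Sum>i\<in>I. \<beta> i $ n) = (\<Sum>i\<in>I. coeff (g i ^ m) (r * m))"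
        unfolding m by (intro sum.cong refl lagrange_log_derivative[OF \<chi> \<beta>])
      also have "\<dots> = (if m = 0 then of_nat (card I) else 0)"
        using vanish[of m] by simp
      finally show ?thesis using True m r by (simp flip: fps_of_nat)
    next
      case False
      then have "n \<noteq> 0" by (rule contrapos_nn) simp
      then show ?thesis using False by (simp flip: fps_of_nat)
    qed
    finally show "(\<Sum>(i, w)\<in>I \<times> R. \<beta> i oo l w) $ n = of_nat (r * card I) $ n" .
  qed
  finally obtain c where P: "P = fps_const c * fps_X ^ (r * card I)"
    using constant_log_derivative_imp_monomial by blast
  have "P \<noteq> 0"
  proof -
    have "x p \<noteq> 0" if pIR: "p \<in> I \<times> R" for p
    proof -
      obtain i w where p: "p = (i, w)" "i \<in> I" "w \<in> R" using pIR by auto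
      have "x p $ 1 \<noteq> 0" using p \<chi>(2)[of i] R(2) by (auto simp: x_def l_def fps_compose_linear)
      then show ?thesis by auto
    qed
    then show ?thesis using finS by (simp add: P_def)
  qed
  then have c: "c \<noteq> 0" using P by auto
  \<comment> \<open>Every factor of \<open>P\<close> is integral over the polynomials in \<open>s = X\<^sup>-\<^sup>r\<close>.\<close>
  define s where "s = (fls_shift (int r) 1 :: 'k fls)"
  interpret E: comm_ring_map "FL.ev s" by (rule FL.ev_ring_map)
  interpret E: field_valued_map "FL.ev s" ..
  have E0: "FL.ev s p $$ 0 = coeff p 0" for p
  proof -
    have "FL.ev s p $$ 0 = (\<Sum>j\<le>degree p. if j = 0 then coeff p j else 0)"
      unfolding FL.ev_sum_atMost[OF order_refl] fls_nth_sum
      using r by (intro sum.cong) (auto simp: s_def fls_X_intpow_power[of "- int r", simplified])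
    then show ?thesis by simp
  qed
  have int: "E.integral (fps_to_fls (x p))" if p: "p \<in> I \<times> R" for p
  proof -
    obtain i w where iw: "p = (i, w)" "i \<in> I" "w \<in> R" using p by auto
    define y where "y = fps_to_fls (x p)"
    define n where "n = degree (g i)"
    have n: "n > r" using deg iw by (simp add: n_def)
    have "fps_X ^ r * (fps_of_poly (g i) oo x p) = x p ^ r"
    proof -
      have "(fps_X ^ r * (fps_of_poly (g i) oo \<chi> i)) oo l w = (\<chi> i ^ r) oo l w"
        by (simp add: \<chi> iw)
      then have "(l w) ^ r * (fps_of_poly (g i) oo x p) = x p ^ r"
        using iw by (simp add: fps_compose_mult_distrib[OF l0] fps_compose_power[OF l0, symmetric] l0
          x_def fps_compose_assoc[OF l0 \<chi>(1)])
      moreover have "(l w) ^ r = fps_X ^ r"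
        using iw by (simp add: l_def power_mult_distrib R_def fps_const_power)
      ultimately show ?thesis by simp
    qed
    moreover have "fps_of_poly (g i) oo x p = (\<Sum>k\<le>n. fps_const (coeff (g i) k) * x p ^ k)"
    proof -
      have x0: "x p $ 0 = 0" using iw \<chi>(1) by (simp add: x_def)
      have "fps_of_poly (g i) = fps_of_poly (\<Sum>k\<le>n. monom (coeff (g i) k) k)"
        by (simp add: poly_as_sum_of_monoms n_def)
      also have "\<dots> = (\<Sum>k\<le>n. fps_const (coeff (g i) k) * fps_X ^ k)"
        by (simp add: fps_of_poly_sum fps_of_poly_monom)
      also have "\<dots> oo x p = (\<Sum>k\<le>n. fps_const (coeff (g i) k) * x p ^ k)"
        by (simp add: fps_compose_sum_distrib fps_compose_mult_distrib[OF x0] x0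
          fps_compose_power[OF x0, symmetric])
      finally show ?thesis .
    qed
    ultimately have "fps_to_fls (fps_X ^ r * (\<Sum>k\<le>n. fps_const (coeff (g i) k) * x p ^ k)) = y ^ r"
      by (simp add: y_def fps_to_fls_power)
    then have "fls_X ^ r * (\<Sum>k\<le>n. fls_const (coeff (g i) k) * y ^ k) = y ^ r"
      by (simp add: y_def fps_to_fls_power fls_times_fps_to_fls fps_to_fls_sum)
    then have "s * (fls_X ^ r * (\<Sum>k\<le>n. fls_const (coeff (g i) k) * y ^ k)) = s * y ^ r" by simp
    moreover have "s * fls_X ^ r = 1" by (simp add: s_def fls_X_power_times_conv_shift)
    ultimately have eq: "(\<Sum>k\<le>n. fls_const (coeff (g i) k) * y ^ k) = s * y ^ r"
      by (simp add: mult.assoc[symmetric])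
    define a where "a = coeff (g i) n"
    have a: "a \<noteq> 0" using n by (auto simp: a_def n_def)
    define d where "d k = smult (inverse a) ((if k = r then [:0, 1:] else 0) - [:coeff (g i) k:])" for k
    have "(\<Sum>k<n. FL.ev s (d k) * y ^ k)
        = fls_const (inverse a) * (\<Sum>k<n. (if k = r then s * y ^ k else 0) - fls_const (coeff (g i) k) * y ^ k)"
      unfolding sum_distrib_left
      by (intro sum.cong refl)
        (simp add: d_def FL.ev_smult E.hom_diff FL.ev_pCons FL.ev_0 algebra_simps)
    also have "\<dots> = fls_const (inverse a) * (s * y ^ r - (\<Sum>k<n. fls_const (coeff (g i) k) * y ^ k))"
      using n by (simp add: sum_subtractf)
    also have "s * y ^ r - (\<Sum>k<n. fls_const (coeff (g i) k) * y ^ k) = fls_const a * y ^ n"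
      unfolding eq[symmetric] a_def by (simp add: lessThan_Suc_atMost[symmetric])
    also have "fls_const (inverse a) * (fls_const a * y ^ n) = y ^ n"
      using a by (simp add: mult.assoc[symmetric])
    finally show ?thesis unfolding E.integral_def y_def[symmetric] by metis
  qed
  define b where "b = monom (inverse c) (card I)"
  have "(\<Prod>p\<in>I \<times> R. fps_to_fls (x p)) * FL.ev s b = 1"
  proof -
    have "(\<Prod>p\<in>T. fps_to_fls (x p)) = fps_to_fls (\<Prod>p\<in>T. x p)" for T
      by (induction T rule: infinite_finite_induct) (simp_all add: fls_times_fps_to_fls)
    then have prod: "(\<Prod>p\<in>I \<times> R. fps_to_fls (x p)) = fls_const c * fls_X ^ (r * card I)"
      using P by (simp only: P_def fls_times_fps_to_fls fps_to_fls_power fps_const_to_fls fps_X_to_fls)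
    have evb: "FL.ev s b = fls_const (inverse c) * s ^ card I"
      by (simp add: b_def FL.ev_monom)
    have "s * fls_X ^ r = 1" by (simp add: s_def fls_X_power_times_conv_shift)
    then have "fls_X ^ (r * card I) * s ^ card I = 1"
      by (simp add: power_mult mult.commute flip: power_mult_distrib)
    moreover have "fls_const c * fls_const (inverse c) = 1" using c by simp
    moreover have "(\<Prod>p\<in>I \<times> R. fps_to_fls (x p)) * FL.ev s b
        = (fls_const c * fls_const (inverse c)) * (fls_X ^ (r * card I) * s ^ card I)"
      unfolding prod evb by (simp only: mult_ac)
    ultimately show ?thesis by (simp only: mult_1_left)
  qed
  then obtain a where "FL.ev s (b * a) = 1"
    using E.inverse_of_integral_product[OF finS, of "\<lambda>p. fps_to_fls (x p)" b] int by auto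
  then have "coeff (b * a) 0 = 1" using E0[of "b * a"] by simp
  moreover have "coeff b 0 = 0" using fin by (simp add: b_def card_gt_0_iff)
  ultimately show False by (simp add: coeff_mult)
qed

text \<open>
  The coefficient of \<open>g ^ m\<close> at \<open>r * m\<close> is the constant term of the \<open>m\<close>-th power of \<open>g / x\<^sup>r\<close>. When the
  exponent 0 of \<open>g / x\<^sup>r\<close> is extreme, that is \<open>r = 0\<close> or \<open>r = n\<close>, the constant terms of the powers are
  the powers of an extreme coefficient, and power sums settle the matter.
\<close>
lemma constant_terms_of_powers_nonzero:
  fixes g :: "'i \<Rightarrow> 'k::{alg_closed_field,field_char_0} poly"
  assumes fin: "finite I" "I \<noteq> {}" and r: "r \<le> n"
    and g0: "\<And>i. i \<in> I \<Longrightarrow> coeff (g i) 0 \<noteq> 0"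
    and deg: "\<And>i. i \<in> I \<Longrightarrow> degree (g i) = n"
  shows "\<exists>m\<ge>1. (\<Sum>i\<in>I. coeff (g i ^ m) (r * m)) \<noteq> 0"
proof (rule ccontr)
  assume "\<not> ?thesis"
  then have vanish: "(\<Sum>i\<in>I. coeff (g i ^ m) (r * m)) = 0" if "m \<ge> 1" for m
    using that by blast
  obtain i where i: "i \<in> I" using fin by auto
  consider "r = 0" | "r = n" | "r \<ge> 1" "r < n" using r by linarith
  then show False
  proof cases
    case 1
    have "coeff (g i) 0 = 0"
      by (rule power_sums_eq_0_imp_eq_0[OF fin(1) _ i])
        (use vanish 1 in \<open>simp add: coeff_0_power\<close>)
    then show ?thesis using g0 i by simp
  next
    case 2
    have "lead_coeff (g i) = 0"
    proof (rule power_sums_eq_0_imp_eq_0[OF fin(1) _ i])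
      fix m :: nat assume m: "m \<ge> 1"
      have "(\<Sum>i\<in>I. lead_coeff (g i) ^ m) = (\<Sum>i\<in>I. coeff (g i ^ m) (r * m))"
      proof (intro sum.cong refl)
        fix j assume j: "j \<in> I"
        have "g j \<noteq> 0" using g0[OF j] by auto
        then have "degree (g j ^ m) = r * m" using deg[OF j] 2 by (simp add: degree_power_eq mult.commute)
        then show "lead_coeff (g j) ^ m = coeff (g j ^ m) (r * m)" by (simp flip: lead_coeff_power)
      qed
      then show "(\<Sum>i\<in>I. lead_coeff (g i) ^ m) = 0" using vanish[OF m] by simp
    qed
    then show ?thesis using g0[OF i] by simp
  next
    case 3
    then show ?thesis
      using two_sided_constant_terms_contradiction[OF fin, of r g] g0 deg vanish by auto
  qed
qed

section \<open>Polynomials in two variables\<close>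
context comm_ring_map
begin

definition ev2 :: "'b \<Rightarrow> 'b \<Rightarrow> 'a poly poly \<Rightarrow> 'b"
  where "ev2 x y = comm_ring_map.ev (ev x) y"

lemma ev2_ring_map: "comm_ring_map (ev2 x y)"
  unfolding ev2_def by (rule comm_ring_map.ev_ring_map[OF ev_ring_map])

lemma ev2_const2: "ev2 x y (const2 c) = h c"
  by (simp add: ev2_def const2_def comm_ring_map.ev_const[OF ev_ring_map] ev_const)

lemma ev2_X1: "ev2 x y X1 = x"
  by (simp add: ev2_def X1_def comm_ring_map.ev_const[OF ev_ring_map] ev_pCons ev_0 hom_zero hom_one)

lemma ev2_X2: "ev2 x y X2 = y"
  by (simp add: ev2_def X2_def comm_ring_map.ev_pCons[OF ev_ring_map]
    comm_ring_map.ev_0[OF ev_ring_map] comm_ring_map.hom_one[OF ev_ring_map]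
    comm_ring_map.hom_zero[OF ev_ring_map])

end

definition coeff2 :: "'k::zero poly poly \<Rightarrow> nat \<Rightarrow> nat \<Rightarrow> 'k"
  where "coeff2 f a b = coeff (coeff f b) a"

definition supp :: "'k::zero poly poly \<Rightarrow> (nat \<times> nat) set"
  where "supp f = {(a, b). coeff2 f a b \<noteq> 0}"

lemma coeff2_eqI: "(\<And>a b. coeff2 f a b = coeff2 g a b) \<Longrightarrow> f = g"
  unfolding coeff2_def by (intro poly_eqI) auto

lemma coeff2_simps:
  "coeff2 0 a b = 0" "coeff2 (f + g) a b = coeff2 f a b + coeff2 g a b" "coeff2 (f - g) a b = coeff2 f a b - coeff2 g a b"
  by (simp_all add: coeff2_def)

lemma coeff2_sum: "coeff2 (\<Sum>i\<in>A. f i) a b = (\<Sum>i\<in>A. coeff2 (f i) a b)"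
  by (simp add: coeff2_def coeff_sum)

lemma coeff2_scale2: "coeff2 (scale2 c f) a b = c * coeff2 f a b"
  by (simp add: coeff2_def scale2_def const2_def)

lemma coeff2_mult: "coeff2 (f * g) a b = (\<Sum>j\<le>b. \<Sum>i\<le>a. coeff2 f i j * coeff2 g (a - i) (b - j))"
  by (simp add: coeff2_def coeff_mult coeff_sum)

lemma X1_X2_power: "X1 ^ a * X2 ^ b = monom (monom 1 a) b"
  by (simp add: X1_def X2_def monom_altdef poly_const_pow)

lemma coeff2_X1_X2_power: "coeff2 (X1 ^ a * X2 ^ b) i j = (if a = i \<and> b = j then 1 else 0)"
  by (auto simp: X1_X2_power coeff2_def)

lemma sum_single_index:
  assumes "finite S"
  shows "(\<Sum>(a, b)\<in>S. if a = i \<and> b = j then F a b else 0) = (if (i, j) \<in> S then F i j else 0)"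
proof -
  have "(\<Sum>(a, b)\<in>S. if a = i \<and> b = j then F a b else 0) = (\<Sum>p\<in>S. if p = (i, j) then F i j else 0)"
    by (intro sum.cong) (auto split: if_splits)
  then show ?thesis using assms by simp
qed

lemma finite_supp: "finite (supp f)"
proof (rule finite_subset)
  show "supp f \<subseteq> (\<Union>b\<le>degree f. {..degree (coeff f b)} \<times> {b})"
    by (auto simp: supp_def coeff2_def intro!: le_degree)
qed auto

lemma sum_monomials:
  assumes "finite S" "supp f \<subseteq> S"
  shows "f = (\<Sum>(a, b)\<in>S. scale2 (coeff2 f a b) (X1 ^ a * X2 ^ b))"
proof (rule coeff2_eqI)
  fix i j
  have "coeff2 (\<Sum>(a, b)\<in>S. scale2 (coeff2 f a b) (X1 ^ a * X2 ^ b)) i j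
      = (\<Sum>(a, b)\<in>S. if a = i \<and> b = j then coeff2 f a b else 0)"
    by (simp add: coeff2_sum case_prod_unfold coeff2_scale2 coeff2_X1_X2_power if_distrib cong: if_cong)
  also have "\<dots> = coeff2 f i j"
    using assms by (auto simp: sum_single_index supp_def)
  finally show "coeff2 f i j = coeff2 (\<Sum>(a, b)\<in>S. scale2 (coeff2 f a b) (X1 ^ a * X2 ^ b)) i j" by simp
qed

lemma (in comm_ring_map) ev2_sum:
  assumes "finite S" "supp f \<subseteq> S"
  shows "ev2 x y f = (\<Sum>(a, b)\<in>S. h (coeff2 f a b) * x ^ a * y ^ b)"
proof -
  interpret E: comm_ring_map "ev2 x y" by (rule ev2_ring_map)
  have "ev2 x y f = ev2 x y (\<Sum>(a, b)\<in>S. scale2 (coeff2 f a b) (X1 ^ a * X2 ^ b))"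
    using sum_monomials[OF assms] by simp
  also have "\<dots> = (\<Sum>(a, b)\<in>S. h (coeff2 f a b) * x ^ a * y ^ b)"
    by (simp add: E.hom_sum case_prod_unfold scale2_def E.hom_mult E.hom_power ev2_const2 ev2_X1 ev2_X2
      mult.assoc)
  finally show ?thesis .
qed

lemma comm_ring_map_const2: "comm_ring_map const2"
  by unfold_locales (simp_all add: const2_def one_pCons)

interpretation K2: comm_ring_map const2
  by (rule comm_ring_map_const2)

section \<open>Endomorphisms and the images of their differences from the identity\<close>
locale poly_endo = comm_ring_map \<phi> for \<phi> :: "'k::comm_ring_1 poly poly \<Rightarrow> 'k poly poly" +
  assumes fixes_const: "\<phi> (const2 c) = const2 c"
begin

lemma hom_scale2: "\<phi> (scale2 c p) = scale2 c (\<phi> p)"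
  by (simp add: scale2_def hom_mult fixes_const)

lemma hom_monomials:
  assumes "finite S" "supp f \<subseteq> S"
  shows "\<phi> f = (\<Sum>(a, b)\<in>S. scale2 (coeff2 f a b) (\<phi> X1 ^ a * \<phi> X2 ^ b))"
  by (subst sum_monomials[OF assms])
    (simp add: hom_sum case_prod_unfold hom_scale2 hom_mult hom_power)

lemma coeff2_hom:
  assumes "finite S" "supp f \<subseteq> S"
  shows "coeff2 (\<phi> f) i j = (\<Sum>(a, b)\<in>S. coeff2 f a b * coeff2 (\<phi> X1 ^ a * \<phi> X2 ^ b) i j)"
  unfolding hom_monomials[OF assms] by (simp add: coeff2_sum case_prod_unfold coeff2_scale2)

end

lemma poly_endo_eqI:
  assumes "poly_endo \<phi>" "poly_endo \<psi>" "\<phi> X1 = \<psi> X1" "\<phi> X2 = \<psi> X2"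
  shows "\<phi> f = \<psi> f"
  using poly_endo.hom_monomials[OF assms(1) finite_supp order_refl, of f]
    poly_endo.hom_monomials[OF assms(2) finite_supp order_refl, of f] assms(3,4)
  by simp

lemma poly_endo_comp:
  assumes "poly_endo \<phi>" "poly_endo \<psi>"
  shows "poly_endo (\<lambda>f. \<phi> (\<psi> f))"
proof -
  interpret A: poly_endo \<phi> by fact
  interpret B: poly_endo \<psi> by fact
  show ?thesis
    by unfold_locales
      (simp_all add: A.hom_add B.hom_add A.hom_mult B.hom_mult A.hom_one B.hom_one A.fixes_const B.fixes_const)
qed

lemma poly_endo_id: "poly_endo (\<lambda>f. f)"
  by unfold_locales simp_all

lemma poly_endo_subst: "poly_endo (K2.ev2 u v)"
  by (intro poly_endo.intro K2.ev2_ring_map poly_endo_axioms.intro K2.ev2_const2)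

lemma algebra_endomorphism_imp_poly_endo:
  fixes \<phi> :: "'k::comm_ring_1 poly poly \<Rightarrow> 'k poly poly"
  assumes "algebra_endomorphism \<phi>"
  shows "poly_endo \<phi>"
proof -
  have hom: "module_hom scale2 scale2 \<phi>" and one: "\<phi> 1 = 1" and mult: "\<And>p q. \<phi> (p * q) = \<phi> p * \<phi> q"
    using assms by (auto simp: algebra_endomorphism_def)
  show ?thesis
  proof
    show "\<phi> (a + b) = \<phi> a + \<phi> b" for a b by (rule module_hom.add[OF hom])
    have "\<phi> (scale2 c 1) = scale2 c (\<phi> 1)" for c by (rule module_hom.scale[OF hom])
    then show "\<phi> (const2 c) = const2 c" for c by (simp add: one scale2_def)
  qed (simp_all add: one mult)
qed

definition im_diff :: "('k::comm_ring_1 poly poly \<Rightarrow> 'k poly poly) \<Rightarrow> 'k poly poly set"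
  where "im_diff \<phi> = range (\<lambda>f. f - \<phi> f)"

context poly_endo
begin

lemma im_zero: "0 \<in> im_diff \<phi>"
  unfolding im_diff_def by (rule range_eqI[of _ _ 0]) (simp add: hom_zero)

lemma im_add:
  assumes "p \<in> im_diff \<phi>" "q \<in> im_diff \<phi>"
  shows "p + q \<in> im_diff \<phi>"
proof -
  obtain f g where "p = f - \<phi> f" "q = g - \<phi> g" using assms by (auto simp: im_diff_def)
  then have "p + q = (f + g) - \<phi> (f + g)" by (simp add: hom_add)
  then show ?thesis by (auto simp: im_diff_def)
qed

lemma im_scale:
  assumes "p \<in> im_diff \<phi>"
  shows "scale2 c p \<in> im_diff \<phi>"
proof -
  obtain f where "p = f - \<phi> f" using assms by (auto simp: im_diff_def)
  then have "scale2 c p = scale2 c f - \<phi> (scale2 c f)"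
    by (simp add: hom_scale2) (simp add: scale2_def algebra_simps)
  then show ?thesis by (auto simp: im_diff_def)
qed

lemma im_sum: "(\<And>i. i \<in> A \<Longrightarrow> f i \<in> im_diff \<phi>) \<Longrightarrow> (\<Sum>i\<in>A. f i) \<in> im_diff \<phi>"
  by (induction A rule: infinite_finite_induct) (simp_all add: im_zero im_add)

lemma im_diff_mem: "f - \<phi> f \<in> im_diff \<phi>"
  by (auto simp: im_diff_def)

lemma im_scaleD:
  assumes "scale2 c p \<in> im_diff \<phi>" "c * d = 1"
  shows "p \<in> im_diff \<phi>"
proof -
  have "scale2 d (scale2 c p) = const2 (c * d) * p"
    by (simp only: scale2_def K2.hom_mult mult_ac)
  then have "scale2 d (scale2 c p) = p" by (simp add: assms(2) K2.hom_one)
  then show ?thesis using im_scale[OF assms(1), of d] by simp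
qed

lemma im_of_monomials:
  assumes "\<And>a b. coeff2 f a b \<noteq> 0 \<Longrightarrow> X1 ^ a * X2 ^ b \<in> im_diff \<phi>"
  shows "f \<in> im_diff \<phi>"
  by (subst sum_monomials[OF finite_supp order_refl])
    (use assms in \<open>auto simp: supp_def intro!: im_sum im_scale\<close>)

end

lemma mathieu_zhao_im_diffI:
  fixes \<phi> :: "'k::field poly poly \<Rightarrow> 'k poly poly"
  assumes "poly_endo \<phi>"
    and "\<And>f g. (\<And>m. m \<ge> 1 \<Longrightarrow> f ^ m \<in> im_diff \<phi>) \<Longrightarrow> \<exists>N. \<forall>m\<ge>N. g * f ^ m \<in> im_diff \<phi>"
  shows "mathieu_zhao_space (im_diff \<phi>)"
proof -
  interpret poly_endo \<phi> by fact
  interpret vector_space "scale2 :: 'k \<Rightarrow> _" by (rule vector_space_scale2)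
  have "subspace (im_diff \<phi>)"
    by (intro subspaceI im_zero im_add im_scale)
  then show ?thesis
    using assms(2) by (simp add: mathieu_zhao_space_def eventually_sequentially)
qed

text \<open>
  The automorphism \<open>\<sigma>\<close> carries the image of \<open>I - \<psi>\<close> onto the image of \<open>I - \<phi>\<close>, and it suffices to
  check the relations between the endomorphisms on the two variables.
\<close>
lemma mathieu_zhao_conjugate:
  fixes \<phi> :: "'k::field poly poly \<Rightarrow> 'k poly poly"
  assumes "poly_endo \<phi>" "poly_endo \<psi>" "poly_endo \<sigma>" "poly_endo \<tau>"
    and inv: "\<sigma> (\<tau> X1) = X1" "\<sigma> (\<tau> X2) = X2" "\<tau> (\<sigma> X1) = X1" "\<tau> (\<sigma> X2) = X2"
    and conj: "\<phi> (\<sigma> X1) = \<sigma> (\<psi> X1)" "\<phi> (\<sigma> X2) = \<sigma> (\<psi> X2)"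
    and mz: "mathieu_zhao_space (im_diff \<psi>)"
  shows "mathieu_zhao_space (im_diff \<phi>)"
proof -
  interpret S: poly_endo \<sigma> by fact
  interpret T: poly_endo \<tau> by fact
  have st: "\<sigma> (\<tau> f) = f" for f
    by (rule poly_endo_eqI[OF poly_endo_comp[OF assms(3,4)] poly_endo_id]) (simp_all add: inv)
  have ts: "\<tau> (\<sigma> f) = f" for f
    by (rule poly_endo_eqI[OF poly_endo_comp[OF assms(4,3)] poly_endo_id]) (simp_all add: inv)
  have ps: "\<phi> (\<sigma> f) = \<sigma> (\<psi> f)" for f
    by (rule poly_endo_eqI[OF poly_endo_comp[OF assms(1,3)] poly_endo_comp[OF assms(3,2)]])
      (simp_all add: conj)
  have mem: "f \<in> im_diff \<phi> \<longleftrightarrow> \<tau> f \<in> im_diff \<psi>" for f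
  proof
    assume "f \<in> im_diff \<phi>"
    then obtain q where "f = q - \<phi> q" by (auto simp: im_diff_def)
    then have "\<tau> f = \<tau> q - \<psi> (\<tau> q)"
      using ps[of "\<tau> q"] by (simp add: T.hom_diff st ts)
    then show "\<tau> f \<in> im_diff \<psi>" by (auto simp: im_diff_def)
  next
    assume "\<tau> f \<in> im_diff \<psi>"
    then obtain q where q: "\<tau> f = q - \<psi> q" by (auto simp: im_diff_def)
    have "f = \<sigma> (\<tau> f)" by (simp add: st)
    also have "\<dots> = \<sigma> q - \<phi> (\<sigma> q)" by (simp add: q S.hom_diff ps)
    finally show "f \<in> im_diff \<phi>" by (auto simp: im_diff_def)
  qed
  show ?thesis
  proof (rule mathieu_zhao_im_diffI[OF assms(1)])
    fix f g assume "\<And>m. m \<ge> 1 \<Longrightarrow> f ^ m \<in> im_diff \<phi>"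
    then have "\<forall>m\<ge>1. \<tau> f ^ m \<in> im_diff \<psi>" by (simp add: mem T.hom_power)
    then have "\<exists>N. \<forall>m\<ge>N. \<tau> g * \<tau> f ^ m \<in> im_diff \<psi>"
      using mz by (simp add: mathieu_zhao_space_def eventually_sequentially)
    then show "\<exists>N. \<forall>m\<ge>N. g * f ^ m \<in> im_diff \<phi>"
      by (simp add: mem T.hom_power T.hom_mult)
  qed
qed

section \<open>Images for the normal forms\<close>

text \<open>
  By induction on the degree of \<open>h\<close>, whose leading term is removed by the image of a monomial.
\<close>
lemma shift_minus_scaled_surj:
  fixes c \<mu> :: "'k::field_char_0"
  assumes "c \<noteq> 0"
  shows "\<exists>p. p - smult \<mu> (pcompose p [:c, 1:]) = h"
proof -
  define T where "T p = p - smult \<mu> (pcompose p [:c, 1:])" for p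
  have T_add: "T (p + q) = T p + T q" for p q
    by (simp add: T_def pcompose_add smult_add_right)
  have T_monom: "T (monom b n) = monom b n - smult (\<mu> * b) ([:c, 1:] ^ n)" for b n
  proof -
    have "pcompose (monom b n) [:c, 1:] = smult b ([:c, 1:] ^ n)"
      by (induction n) (simp_all add: monom_0 monom_Suc pcompose_pCons)
    then show ?thesis by (simp add: T_def)
  qed
  have coeff_lin: "coeff ([:c, 1:] ^ n) k = of_nat (n choose k) * c ^ (n - k)" for n k
  proof (cases "k \<le> n")
    case True then show ?thesis by (simp add: coeff_linear_poly_power)
  next
    case False
    have "degree ([:c, 1:] ^ n) \<le> n" using degree_power_le[of "[:c, 1:]" n] by simp
    then show ?thesis using False by (simp add: coeff_eq_0)
  qed
  \<comment> \<open>Some monomial is sent to one of degree \<open>n\<close>: for \<open>\<mu> = 1\<close> the degree drops by one.\<close>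
  have top: "\<exists>q. coeff (T q) n = a \<and> (\<forall>k>n. coeff (T q) k = 0)" for a n
  proof (cases "\<mu> = 1")
    case False
    have "coeff (T (monom (a / (1 - \<mu>)) n)) k = (if k = n then a else 0)" if "k \<ge> n" for k
      using that False by (auto simp: T_monom coeff_lin field_simps)
    then show ?thesis by (intro exI[of _ "monom (a / (1 - \<mu>)) n"]) auto
  next
    case True
    define b where "b = - a / (of_nat (Suc n) * c)"
    have "coeff (T (monom b (Suc n))) k = (if k = n then a else 0)" if kn: "k \<ge> n" for k
    proof -
      consider "k = n" | "k = Suc n" | "k > Suc n"
        using kn by (cases "k = n"; cases "k = Suc n"; auto)
      then show ?thesis
      proof cases
        case 1
        have "of_nat (Suc n) * c \<noteq> 0" using assms by (simp del: of_nat_Suc)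
        then have "b * (of_nat (Suc n) * c) = - a" by (simp add: b_def)
        then show ?thesis using 1 True
          by (simp add: T_monom coeff_lin mult.assoc del: of_nat_Suc power_Suc)
      qed (use True in \<open>simp_all add: T_monom coeff_lin del: power_Suc\<close>)
    qed
    then show ?thesis by (intro exI[of _ "monom b (Suc n)"]) auto
  qed
  have "\<forall>k\<ge>n. coeff h k = 0 \<Longrightarrow> \<exists>p. T p = h" for n
  proof (induction n arbitrary: h)
    case 0
    then have "h = 0" by (intro poly_eqI) simp
    then show ?case by (intro exI[of _ 0]) (simp add: T_def)
  next
    case (Suc n)
    obtain q where q: "coeff (T q) n = coeff h n" "\<forall>k>n. coeff (T q) k = 0" using top by blast
    have "\<forall>k\<ge>n. coeff (h - T q) k = 0"
    proof (intro allI impI)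
      fix k assume "k \<ge> n"
      then show "coeff (h - T q) k = 0" using q Suc.prems by (cases "k = n") auto
    qed
    then obtain p where "T p = h - T q" using Suc.IH by blast
    then have "T (p + q) = h" by (simp add: T_add)
    then show ?case ..
  qed
  from this[of "Suc (degree h)"] show ?thesis by (simp add: T_def coeff_eq_0)
qed

text \<open>
  On the coefficient of the highest power \<open>x\<^sub>2\<^sup>n\<close>, the map \<open>I - \<phi>\<close> acts as \<open>p(x) - \<mu>\<^sup>n p(x + c)\<close>, which
  is onto in one variable; the rest is induction on the degree in \<open>x\<^sub>2\<close>.
\<close>
lemma im_diff_translation:
  fixes \<phi> :: "'k::field_char_0 poly poly \<Rightarrow> 'k poly poly"
  assumes "poly_endo \<phi>" and c: "c \<noteq> 0"
    and X1: "\<phi> X1 = X1 + const2 c"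
    and X2: "\<phi> X2 = const2 \<mu> * X2 + const2 \<epsilon> * X1 + const2 d"
  shows "im_diff \<phi> = UNIV"
proof -
  interpret poly_endo \<phi> by fact
  have inner: "\<phi> [:p:] = [:pcompose p [:c, 1:]:]" for p
  proof (induction p)
    case (pCons a p)
    have "[:pCons a p:] = const2 a + X1 * [:p:]" by (simp add: const2_def X1_def)
    then have "\<phi> [:pCons a p:] = const2 a + (X1 + const2 c) * [:pcompose p [:c, 1:]:]"
      by (simp only: hom_add hom_mult fixes_const X1 pCons.IH)
    then show ?case
      by (simp add: const2_def X1_def pcompose_pCons algebra_simps)
  qed (simp add: hom_zero)
  have X2': "\<phi> X2 = [:[:d, \<epsilon>:], [:\<mu>:]:]"
    by (simp add: X2) (simp add: const2_def X1_def X2_def)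
  define w where "w p n = [:p:] * X2 ^ n" for p :: "'k poly" and n
  have \<phi>w: "\<phi> (w p n) = smult (pcompose p [:c, 1:]) ([:[:d, \<epsilon>:], [:\<mu>:]:] ^ n)" for p n
    unfolding w_def hom_mult hom_power inner X2' by simp
  have w_coeff: "coeff (w p n) k = (if k = n then p else 0)" for p n k
    by (simp add: w_def X2_def flip: monom_altdef)
  have coeff_w: "coeff (w p n - \<phi> (w p n)) k
      = (if k = n then p - smult (\<mu> ^ n) (pcompose p [:c, 1:]) else 0)" if "k \<ge> n" for p n k
  proof (cases "k = n")
    case True
    then show ?thesis by (simp add: w_coeff \<phi>w coeff_linear_poly_power poly_const_pow)
  next
    case False
    have "degree ([:[:d, \<epsilon>:], [:\<mu>:]:] ^ n) \<le> 1 * n"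
      by (rule order_trans[OF degree_power_le]) (simp add: mult.commute)
    then show ?thesis using that False by (simp add: w_coeff \<phi>w coeff_eq_0)
  qed
  have "\<forall>k\<ge>n. coeff f k = 0 \<Longrightarrow> f \<in> im_diff \<phi>" for n f
  proof (induction n arbitrary: f)
    case 0
    then have "f = 0" by (intro poly_eqI) simp
    then show ?case by (simp add: im_zero)
  next
    case (Suc n)
    obtain p where p: "p - smult (\<mu> ^ n) (pcompose p [:c, 1:]) = coeff f n"
      using shift_minus_scaled_surj[OF c] by blast
    define e where "e = w p n - \<phi> (w p n)"
    have e: "coeff e k = (if k = n then coeff f n else 0)" if "k \<ge> n" for k
      unfolding e_def coeff_w[OF that] p ..
    have "\<forall>k\<ge>n. coeff (f - e) k = 0"
    proof (intro allI impI)
      fix k assume "k \<ge> n"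
      then show "coeff (f - e) k = 0" using Suc.prems by (cases "k = n") (auto simp: e)
    qed
    then have "f - e \<in> im_diff \<phi>" by (rule Suc.IH)
    moreover have "e \<in> im_diff \<phi>" unfolding e_def by (rule im_diff_mem)
    ultimately have "(f - e) + e \<in> im_diff \<phi>" by (rule im_add)
    then show ?case by simp
  qed
  from this[of "Suc (degree f)" f for f] show ?thesis by (auto simp: coeff_eq_0)
qed

lemma im_diff_diagonal:
  fixes \<phi> :: "'k::field poly poly \<Rightarrow> 'k poly poly"
  assumes "poly_endo \<phi>"
    and X1: "\<phi> X1 = const2 \<kappa> * X1" and X2: "\<phi> X2 = const2 \<mu> * X2"
  shows "im_diff \<phi> = {f. \<forall>a b. \<kappa> ^ a * \<mu> ^ b = 1 \<longrightarrow> coeff2 f a b = 0}"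
proof -
  interpret poly_endo \<phi> by fact
  have mono: "\<phi> X1 ^ a * \<phi> X2 ^ b = scale2 (\<kappa> ^ a * \<mu> ^ b) (X1 ^ a * X2 ^ b)" for a b
    by (simp add: X1 X2 power_mult_distrib scale2_def K2.hom_mult K2.hom_power)
  have coeff2: "coeff2 (\<phi> f) a b = \<kappa> ^ a * \<mu> ^ b * coeff2 f a b" for f a b
  proof -
    have "coeff2 (\<phi> f) a b = (\<Sum>(i, j)\<in>supp f. if i = a \<and> j = b then \<kappa> ^ i * \<mu> ^ j * coeff2 f i j else 0)"
      unfolding coeff2_hom[OF finite_supp order_refl]
      by (intro sum.cong) (simp_all add: mono coeff2_scale2 coeff2_X1_X2_power case_prod_unfold)
    then show ?thesis by (simp add: sum_single_index[OF finite_supp]) (simp add: supp_def)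
  qed
  show ?thesis
  proof (intro equalityI subsetI)
    fix f assume "f \<in> im_diff \<phi>"
    then show "f \<in> {f. \<forall>a b. \<kappa> ^ a * \<mu> ^ b = 1 \<longrightarrow> coeff2 f a b = 0}"
      by (auto simp: im_diff_def coeff2_simps coeff2)
  next
    fix f :: "'k poly poly"
    assume f: "f \<in> {f. \<forall>a b. \<kappa> ^ a * \<mu> ^ b = 1 \<longrightarrow> coeff2 f a b = 0}"
    show "f \<in> im_diff \<phi>"
    proof (rule im_of_monomials)
      fix a b assume "coeff2 f a b \<noteq> 0"
      then have ne: "1 - \<kappa> ^ a * \<mu> ^ b \<noteq> 0" using f by auto
      have "scale2 (1 - \<kappa> ^ a * \<mu> ^ b) (X1 ^ a * X2 ^ b) = X1 ^ a * X2 ^ b - \<phi> (X1 ^ a * X2 ^ b)"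
        by (simp add: hom_mult hom_power mono) (simp add: scale2_def K2.hom_diff K2.hom_one algebra_simps)
      then have "scale2 (1 - \<kappa> ^ a * \<mu> ^ b) (X1 ^ a * X2 ^ b) \<in> im_diff \<phi>"
        using im_diff_mem by simp
      then show "X1 ^ a * X2 ^ b \<in> im_diff \<phi>"
        by (rule im_scaleD) (rule right_inverse[OF ne])
    qed
  qed
qed

text \<open>
  Modulo lower powers of \<open>x\<^sub>2\<close> in the same degree, \<open>I - \<phi>\<close> multiplies \<open>x\<^sub>1\<^sup>a x\<^sub>2\<^sup>b\<close> by
  \<open>1 - \<kappa>\<^sup>a\<^sup>+\<^sup>b\<close>. If this factor is 0, the next term of the expansion shows that a monomial with one more
  \<open>x\<^sub>1\<close> and one \<open>x\<^sub>2\<close> less is reached instead, so that only a pure power of \<open>x\<^sub>2\<close> is missed.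
\<close>
lemma im_diff_jordan_block:
  fixes \<phi> :: "'k::field_char_0 poly poly \<Rightarrow> 'k poly poly"
  assumes "poly_endo \<phi>"
    and X1: "\<phi> X1 = const2 \<kappa> * X1" and X2: "\<phi> X2 = const2 \<kappa> * X2 + X1"
  shows "im_diff \<phi> = {f. \<forall>b. \<kappa> ^ b = 1 \<longrightarrow> coeff2 f 0 b = 0}"
proof -
  interpret poly_endo \<phi> by fact
  have mono: "\<phi> (X1 ^ a * X2 ^ b) = (\<Sum>k\<le>b. scale2 (of_nat (b choose k) * \<kappa> ^ (a + k)) (X1 ^ (a + (b - k)) * X2 ^ k))"
    for a b
  proof -
    have of_nat: "(of_nat n :: 'k poly poly) = const2 (of_nat n)" for n
      by (induction n) (simp_all add: K2.hom_add K2.hom_one K2.hom_zero)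
    have "\<phi> (X1 ^ a * X2 ^ b) = (const2 \<kappa> * X1) ^ a * (const2 \<kappa> * X2 + X1) ^ b"
      by (simp add: hom_mult hom_power X1 X2)
    also have "\<dots> = (\<Sum>k\<le>b. scale2 (of_nat (b choose k) * \<kappa> ^ (a + k)) (X1 ^ (a + (b - k)) * X2 ^ k))"
      unfolding binomial_ring sum_distrib_left
      by (intro sum.cong refl)
        (simp only: of_nat scale2_def K2.hom_mult K2.hom_power power_mult_distrib power_add mult_ac)
    finally show ?thesis .
  qed
  have coeff2: "coeff2 (\<phi> f) 0 j = \<kappa> ^ j * coeff2 f 0 j" for f j
  proof -
    have "coeff2 (X1 ^ (a + (b - k)) * X2 ^ k) 0 j = 0" if "k < b" for a b k
      using that by (simp add: coeff2_X1_X2_power)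
    then have m: "coeff2 (\<phi> (X1 ^ a * X2 ^ b)) 0 j = (if a = 0 \<and> b = j then \<kappa> ^ j else 0)" for a b
    proof -
      have "coeff2 (\<phi> (X1 ^ a * X2 ^ b)) 0 j
          = (\<Sum>k\<le>b. if k = b then (if a = 0 \<and> b = j then \<kappa> ^ j else 0) else 0)"
        unfolding mono coeff2_sum by (intro sum.cong) (auto simp: coeff2_scale2 coeff2_X1_X2_power)
      then show ?thesis by simp
    qed
    have "coeff2 (\<phi> f) 0 j = (\<Sum>(a, b)\<in>supp f. if a = 0 \<and> b = j then \<kappa> ^ b * coeff2 f a b else 0)"
      unfolding coeff2_hom[OF finite_supp order_refl]
      by (intro sum.cong) (auto simp: m[unfolded hom_mult hom_power])
    then show ?thesis by (simp add: sum_single_index[OF finite_supp]) (simp add: supp_def)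
  qed
  have X1X2: "X1 ^ a * X2 ^ b \<in> im_diff \<phi>" if "a \<ge> 1 \<or> \<kappa> ^ b \<noteq> 1" for a b
    using that
  proof (induction b arbitrary: a rule: less_induct)
    case (less b)
    have low: "(\<Sum>k<b. scale2 (x k) (X1 ^ (a' + (b - k)) * X2 ^ k)) \<in> im_diff \<phi>" for x a'
      by (intro im_sum im_scale less.IH) auto
    show ?case
    proof (cases "\<kappa> ^ (a + b) = 1")
      case False
      define L where "L = (\<Sum>k<b. scale2 (of_nat (b choose k) * \<kappa> ^ (a + k)) (X1 ^ (a + (b - k)) * X2 ^ k))"
      have "\<phi> (X1 ^ a * X2 ^ b) = L + scale2 (\<kappa> ^ (a + b)) (X1 ^ a * X2 ^ b)"
        unfolding mono L_def by (simp add: lessThan_Suc_atMost[symmetric])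
      then have "scale2 (1 - \<kappa> ^ (a + b)) (X1 ^ a * X2 ^ b) = (X1 ^ a * X2 ^ b - \<phi> (X1 ^ a * X2 ^ b)) + L"
        by (simp add: scale2_def K2.hom_diff K2.hom_one algebra_simps)
      then have "scale2 (1 - \<kappa> ^ (a + b)) (X1 ^ a * X2 ^ b) \<in> im_diff \<phi>"
        using im_add[OF im_diff_mem low] by (simp add: L_def)
      then show ?thesis
        by (rule im_scaleD[where d = "inverse (1 - \<kappa> ^ (a + b))"]) (use False in \<open>simp add: right_inverse\<close>)
    next
      case True
      then have "a \<noteq> 0" using less.prems by (intro notI) simp
      then obtain a' where a': "a = Suc a'" by (cases a) auto
      \<comment> \<open>The resonant monomial is reached from the one with one \<open>x\<^sub>1\<close> replaced by \<open>x\<^sub>2\<close>.\<close>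
      define L where "L = (\<Sum>k<b. scale2 (of_nat (Suc b choose k) * \<kappa> ^ (a' + k)) (X1 ^ (a + (b - k)) * X2 ^ k))"
      define C where "C = of_nat (Suc b) * \<kappa> ^ (a' + b)"
      have "\<kappa> \<noteq> 0" using True a' by auto
      then have C: "C \<noteq> 0" by (simp add: C_def del: of_nat_Suc)
      have "\<phi> (X1 ^ a' * X2 ^ Suc b) = L + scale2 C (X1 ^ a * X2 ^ b) + X1 ^ a' * X2 ^ Suc b"
      proof -
        have "(\<Sum>k<b. scale2 (of_nat (Suc b choose k) * \<kappa> ^ (a' + k)) (X1 ^ (a' + (Suc b - k)) * X2 ^ k)) = L"
          unfolding L_def by (intro sum.cong refl) (simp add: a' Suc_diff_le)
        moreover have "scale2 (\<kappa> ^ (a' + Suc b)) p = p" for p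
          using True by (simp add: a' scale2_def K2.hom_one)
        ultimately show ?thesis
          unfolding mono atMost_Suc lessThan_Suc_atMost[symmetric] C_def
          by (simp add: a' del: of_nat_Suc power_Suc) (simp add: algebra_simps)
      qed
      then have "scale2 C (X1 ^ a * X2 ^ b)
          = scale2 (-1) ((X1 ^ a' * X2 ^ Suc b - \<phi> (X1 ^ a' * X2 ^ Suc b)) + L)"
        by (simp add: scale2_def K2.hom_uminus K2.hom_one algebra_simps)
      also have "\<dots> \<in> im_diff \<phi>"
        unfolding L_def by (intro im_scale im_add im_diff_mem low)
      finally show ?thesis
        by (rule im_scaleD) (rule right_inverse[OF C])
    qed
  qed
  show ?thesis
  proof (intro equalityI subsetI)
    fix f assume "f \<in> im_diff \<phi>"
    then show "f \<in> {f. \<forall>b. \<kappa> ^ b = 1 \<longrightarrow> coeff2 f 0 b = 0}"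
      by (auto simp: im_diff_def coeff2_simps coeff2)
  next
    fix f :: "'k poly poly"
    assume f: "f \<in> {f. \<forall>b. \<kappa> ^ b = 1 \<longrightarrow> coeff2 f 0 b = 0}"
    show "f \<in> im_diff \<phi>"
    proof (rule im_of_monomials)
      fix a b assume "coeff2 f a b \<noteq> 0"
      then show "X1 ^ a * X2 ^ b \<in> im_diff \<phi>" using f by (intro X1X2) (cases a; auto)
    qed
  qed
qed

section \<open>Resonances on an axis\<close>
interpretation E1: comm_ring_map "\<lambda>x::'k::comm_ring_1. x"
  by unfold_locales simp_all

definition ev_at :: "'k::comm_ring_1 \<Rightarrow> 'k \<Rightarrow> 'k poly poly \<Rightarrow> 'k"
  where "ev_at = E1.ev2"

interpretation EA: comm_ring_map "ev_at x y"
  unfolding ev_at_def by (rule E1.ev2_ring_map)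

lemma ev_at_sum:
  assumes "finite S" "supp f \<subseteq> S"
  shows "ev_at x y f = (\<Sum>(a, b)\<in>S. coeff2 f a b * x ^ a * y ^ b)"
  unfolding ev_at_def by (rule E1.ev2_sum[OF assms])

lemma ev_at_poly: "ev_at x y f = poly (map_poly (\<lambda>p. poly p x) f) y"
proof -
  have "E1.ev x = (\<lambda>p. poly p x)" by (simp add: fun_eq_iff E1.ev_def)
  then show ?thesis
    unfolding ev_at_def E1.ev2_def comm_ring_map.ev_def[OF E1.ev_ring_map] by simp
qed

lemma ev_at_eq_0_iff:
  fixes f :: "'k::field_char_0 poly poly"
  shows "(\<forall>y. ev_at x y f = 0) \<longleftrightarrow> (\<forall>b. poly (coeff f b) x = 0)"
proof -
  have "(\<forall>y. ev_at x y f = 0) \<longleftrightarrow> map_poly (\<lambda>p. poly p x) f = 0"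
    by (simp add: ev_at_poly poly_all_0_iff_0)
  also have "\<dots> \<longleftrightarrow> (\<forall>b. poly (coeff f b) x = 0)"
    by (simp add: poly_eq_iff coeff_map_poly)
  finally show ?thesis .
qed

lemma ev_at_0_eq_0_iff:
  fixes f :: "'k::field_char_0 poly poly"
  shows "(\<forall>y. ev_at 0 y f = 0) \<longleftrightarrow> (\<forall>b. coeff2 f 0 b = 0)"
  by (simp add: ev_at_eq_0_iff coeff2_def poly_0_coeff_0)

lemma ev_at_all_0_imp:
  fixes f :: "'k::field_char_0 poly poly"
  assumes "\<And>x y. ev_at x y f = 0"
  shows "f = 0"
proof (rule poly_eqI)
  fix b
  have "\<forall>x. poly (coeff f b) x = 0" using assms ev_at_eq_0_iff by blast
  then show "coeff f b = coeff 0 b" by (simp add: poly_all_0_iff_0)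
qed

lemma sum_powers_root_of_unity:
  fixes z :: "'k::field"
  assumes "z ^ N = 1"
  shows "(\<Sum>i<N. z ^ i) = (if z = 1 then of_nat N else 0)"
  using assms by (simp add: geometric_sum)

lemma ev_at_eq_0_of_twisted_power_sums:
  fixes f :: "'k::field_char_0 poly poly"
  assumes N: "N \<ge> 1"
    and vanish: "\<And>m. m \<ge> 1 \<Longrightarrow> (\<Sum>i<N. ev_at (\<kappa> ^ i * x) (\<mu> ^ i * y) (f ^ m)) = 0"
  shows "ev_at x y f = 0"
proof -
  have "ev_at (\<kappa> ^ 0 * x) (\<mu> ^ 0 * y) f = 0"
    by (rule power_sums_eq_0_imp_eq_0[where I = "{..<N}"])
      (use vanish N in \<open>auto simp: EA.hom_power\<close>)
  then show ?thesis by simp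
qed

text \<open>
  Averaging over the powers of \<open>(\<kappa>, \<mu>)\<close> projects onto the resonant monomials, and the hypothesis says
  that none of them contributes at the point \<open>(x, y)\<close>.
\<close>
lemma twisted_sum:
  fixes f :: "'k::field poly poly"
  assumes "\<And>a b. coeff2 f a b * x ^ a * y ^ b \<noteq> 0 \<Longrightarrow> (\<kappa> ^ a * \<mu> ^ b) ^ N = 1 \<and> \<kappa> ^ a * \<mu> ^ b \<noteq> 1"
  shows "(\<Sum>i<N. ev_at (\<kappa> ^ i * x) (\<mu> ^ i * y) f) = 0"
proof -
  have "(\<Sum>i<N. ev_at (\<kappa> ^ i * x) (\<mu> ^ i * y) f)
      = (\<Sum>i<N. \<Sum>(a, b)\<in>supp f. coeff2 f a b * x ^ a * y ^ b * (\<kappa> ^ a * \<mu> ^ b) ^ i)"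
    unfolding ev_at_sum[OF finite_supp order_refl]
    by (intro sum.cong refl)
      (auto simp: power_mult_distrib power_mult[symmetric] mult_ac)
  also have "\<dots> = (\<Sum>(a, b)\<in>supp f. coeff2 f a b * x ^ a * y ^ b * (\<Sum>i<N. (\<kappa> ^ a * \<mu> ^ b) ^ i))"
    by (subst sum.swap) (simp add: case_prod_unfold sum_distrib_left)
  also have "\<dots> = 0"
  proof (intro sum.neutral ballI)
    fix p assume "p \<in> supp f"
    obtain a b where p: "p = (a, b)" by (cases p)
    show "(case p of (a, b) \<Rightarrow> coeff2 f a b * x ^ a * y ^ b * (\<Sum>i<N. (\<kappa> ^ a * \<mu> ^ b) ^ i)) = 0"
      using assms[of a b] by (cases "coeff2 f a b * x ^ a * y ^ b = 0") (auto simp: p sum_powers_root_of_unity)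
  qed
  finally show ?thesis .
qed

text \<open>
  If \<open>\<mu>\<close> is a root of unity, the power sums of the values \<open>f(0, \<mu>\<^sup>i y)\<close> vanish, so \<open>f\<close> vanishes on the
  axis. Otherwise only the exponent 0 is resonant, and \<open>f\<close> vanishes at the origin.
\<close>
lemma resonance_on_axis:
  fixes f g :: "'k::field_char_0 poly poly" and \<mu> :: 'k
  assumes "\<And>m b. m \<ge> 1 \<Longrightarrow> \<mu> ^ b = 1 \<Longrightarrow> coeff2 (f ^ m) 0 b = 0"
    and "m \<ge> 1" "\<mu> ^ b = 1"
  shows "coeff2 (g * f ^ m) 0 b = 0"
proof (cases "\<exists>N\<ge>1. \<mu> ^ N = 1")
  case True
  then obtain N where N: "N \<ge> 1" "\<mu> ^ N = 1" by blast
  have "ev_at 0 y f = 0" for y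
  proof (rule ev_at_eq_0_of_twisted_power_sums[OF N(1), where \<kappa> = 1 and \<mu> = \<mu>])
    fix m :: nat assume m: "m \<ge> 1"
    have "(\<mu> ^ j) ^ N = 1" for j using N(2) by (metis mult.commute power_mult power_one)
    then show "(\<Sum>i<N. ev_at (1 ^ i * 0) (\<mu> ^ i * y) (f ^ m)) = 0"
      using assms(1)[OF m] by (intro twisted_sum) (auto simp: power_0_left split: if_splits)
  qed
  then have "\<forall>y. ev_at 0 y (g * f ^ m) = 0"
    using assms(2) by (simp add: EA.hom_mult EA.hom_power power_0_left)
  then show ?thesis by (simp add: ev_at_0_eq_0_iff)
next
  case False
  then have "b = 0" using assms(3) by (cases b) auto
  moreover have "coeff2 f 0 0 = 0" using assms(1)[of 1 0] by simp
  ultimately show ?thesis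
    using assms(2) by (simp add: coeff2_def coeff_mult_0 coeff_0_power power_0_left)
qed

section \<open>Resonances off the axes\<close>
definition weight_ge :: "int \<Rightarrow> int \<Rightarrow> int \<Rightarrow> 'k::comm_ring_1 poly poly set"
  where "weight_ge u v n = {f. \<forall>a b. coeff2 f a b \<noteq> 0 \<longrightarrow> u * int a + v * int b \<ge> n}"

lemma weight_ge_mult:
  assumes "f \<in> weight_ge u v m" "g \<in> weight_ge u v n"
  shows "f * g \<in> weight_ge u v (m + n)"
  unfolding weight_ge_def
proof (intro CollectI allI impI)
  fix a b assume "coeff2 (f * g) a b \<noteq> 0"
  then obtain i j where ij: "j \<le> b" "i \<le> a" "coeff2 f i j * coeff2 g (a - i) (b - j) \<noteq> 0"
    unfolding coeff2_mult by (meson atMost_iff sum.not_neutral_contains_not_neutral)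
  then have "coeff2 f i j \<noteq> 0" "coeff2 g (a - i) (b - j) \<noteq> 0" by auto
  then have "u * int i + v * int j \<ge> m" "u * int (a - i) + v * int (b - j) \<ge> n"
    using assms unfolding weight_ge_def by blast+
  then show "u * int a + v * int b \<ge> m + n"
    using ij(1,2) by (simp add: of_nat_diff algebra_simps)
qed

lemma weight_ge_power:
  fixes f :: "'k::comm_ring_1 poly poly"
  assumes "f \<in> weight_ge u v n"
  shows "f ^ m \<in> weight_ge u v (int m * n)"
proof (induction m)
  case 0
  have "coeff2 (1 :: 'k poly poly) a b = (if a = 0 \<and> b = 0 then 1 else 0)" for a b
    using coeff2_X1_X2_power[of 0 0 a b] by auto
  then show ?case by (simp add: weight_ge_def)
next
  case (Suc m)
  then show ?case using weight_ge_mult[OF assms Suc] by (simp add: algebra_simps)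
qed

lemma positive_weight_eventually:
  fixes f g :: "'k::comm_ring_1 poly poly"
  assumes "f \<in> weight_ge u v 1"
  shows "\<exists>N. \<forall>m\<ge>N. g * f ^ m \<in> weight_ge u v 1"
proof -
  define W where "W = insert 0 ((\<lambda>(a, b). u * int a + v * int b) ` supp g)"
  have "finite W" by (simp add: W_def finite_supp)
  then have g: "g \<in> weight_ge u v (Min W)"
    by (auto simp: weight_ge_def W_def supp_def intro!: Min_le)
  show ?thesis
  proof (intro exI[of _ "nat (1 - Min W)"] allI impI)
    fix m assume m: "m \<ge> nat (1 - Min W)"
    have "g * f ^ m \<in> weight_ge u v (Min W + int m * 1)"
      by (intro weight_ge_mult weight_ge_power g assms)
    then show "g * f ^ m \<in> weight_ge u v 1"
      using m unfolding weight_ge_def by force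
  qed
qed

text \<open>
  The restriction \<open>f(x z\<^sup>q, y z\<^sup>-\<^sup>p)\<close>, as a Laurent series in \<open>z\<close>. A monomial \<open>x\<^sub>1\<^sup>a x\<^sub>2\<^sup>b\<close> contributes
  to the exponent \<open>q a - p b\<close>.
\<close>
definition on_curve :: "nat \<Rightarrow> nat \<Rightarrow> 'k::comm_ring_1 \<Rightarrow> 'k \<Rightarrow> 'k poly poly \<Rightarrow> 'k fls"
  where "on_curve p q x y = FL.ev2 (fls_const x * fls_shift (- int q) 1) (fls_const y * fls_shift (int p) 1)"

interpretation OC: comm_ring_map "on_curve p q x y"
  unfolding on_curve_def by (rule FL.ev2_ring_map)

lemma on_curve_nth:
  fixes f :: "'k::comm_ring_1 poly poly"
  shows "on_curve p q x y f $$ n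
    = (\<Sum>(a, b)\<in>supp f. if int q * int a - int p * int b = n then coeff2 f a b * x ^ a * y ^ b else 0)"
proof -
  have const_pow: "fls_const c ^ k = fls_const (c ^ k)" for c :: 'k and k
    by (induction k) simp_all
  have "fls_const c * (fls_const x * fls_shift (- int q) 1) ^ a * (fls_const y * fls_shift (int p) 1) ^ b
      = fls_const (c * x ^ a * y ^ b) * fls_shift (int p * int b - int q * int a) 1" for c a b
  proof -
    have "fls_shift (- int q) 1 ^ a = (fls_shift (- (int a * int q)) 1 :: 'k fls)"
      by (rule fls_X_intpow_power)
    moreover have "fls_shift (int p) 1 ^ b = (fls_shift (int b * int p) 1 :: 'k fls)"
      using fls_X_intpow_power[of "- int p" b] by simp
    moreover have "fls_shift (- (int a * int q)) 1 * fls_shift (int b * int p) 1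
        = (fls_shift (int p * int b - int q * int a) 1 :: 'k fls)"
    proof -
      have "- (int a * int q + - (int b * int p)) = int p * int b - int q * int a"
        by (simp add: algebra_simps)
      then show ?thesis
        using fls_X_intpow_times_fls_X_intpow[of "int a * int q" "- (int b * int p)"]
        by (simp only: minus_minus)
    qed
    moreover have "fls_const c * (fls_const x * fls_shift (- int q) 1) ^ a * (fls_const y * fls_shift (int p) 1) ^ b
      = (fls_const c * fls_const (x ^ a) * fls_const (y ^ b)) * (fls_shift (- int q) 1 ^ a * fls_shift (int p) 1 ^ b)"
      unfolding power_mult_distrib const_pow by (simp only: mult_ac)
    ultimately show ?thesis by (simp only: FL.hom_mult)
  qed
  then have "on_curve p q x y f
      = (\<Sum>(a, b)\<in>supp f. fls_const (coeff2 f a b * x ^ a * y ^ b) * fls_shift (int p * int b - int q * int a) 1)"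
    unfolding on_curve_def FL.ev2_sum[OF finite_supp order_refl] by (simp only:)
  then show ?thesis
    by (simp only: fls_nth_sum case_prod_unfold) (intro sum.cong refl, auto simp: algebra_simps)
qed

text \<open>
  Summation over the \<open>p\<close> curves through \<open>(\<kappa>\<^sup>i, \<mu>\<^sup>i y)\<close> selects the resonant ones among the
  monomials of weight 0: on these \<open>\<kappa>\<^sup>a \<mu>\<^sup>b\<close> is a \<open>p\<close>-th root of unity, because \<open>p b = q a\<close> and
  \<open>\<kappa>\<^sup>p \<mu>\<^sup>q = 1\<close>. Hence the constant terms of the powers add up to 0, which the theorem on constant terms
  excludes unless 0 lies outside the range of weights of \<open>f\<close>.
\<close>
lemma definite_weight_of_no_resonance:
  fixes f :: "'k::{alg_closed_field,field_char_0} poly poly" and \<kappa> \<mu> :: 'k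
  assumes pq: "p \<ge> 1" "q \<ge> 1" and res: "\<kappa> ^ p * \<mu> ^ q = 1"
    and vanish: "\<And>m a b. m \<ge> 1 \<Longrightarrow> \<kappa> ^ a * \<mu> ^ b = 1 \<Longrightarrow> coeff2 (f ^ m) a b = 0"
  shows "f \<in> weight_ge (int q) (- int p) 1 \<or> f \<in> weight_ge (- int q) (int p) 1"
proof (rule ccontr)
  define wt where "wt = (\<lambda>(a, b). int q * int a - int p * int b)"
  define W where "W = wt ` supp f"
  have finW: "finite W" by (simp add: W_def finite_supp)
  assume "\<not> ?thesis"
  then obtain s t where s: "s \<in> supp f" "wt s \<le> 0" and t: "t \<in> supp f" "wt t \<ge> 0"
    unfolding weight_ge_def supp_def wt_def by force
  define w0 w1 where "w0 = Min W" and "w1 = Max W"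
  have w: "w0 \<in> W" "w1 \<in> W" using finW s(1) by (auto simp: w0_def w1_def W_def intro!: Min_in Max_in)
  have "w0 \<le> wt s" using finW s(1) by (auto simp: w0_def W_def intro!: Min_le)
  then have w0: "w0 \<le> 0" using s(2) by simp
  have "wt t \<le> w1" using finW t(1) by (auto simp: w1_def W_def intro!: Max_ge)
  then have w1: "w1 \<ge> 0" using t(2) by simp
  have bounds: "w0 \<le> wt s" "wt s \<le> w1" if "s \<in> supp f" for s
    using finW that by (auto simp: w0_def w1_def W_def intro!: Min_le Max_ge)
  have nz: "\<kappa> \<noteq> 0" "\<mu> \<noteq> 0" using res pq by (auto simp: power_0_left)

  \<comment> \<open>A parameter \<open>y\<close> for which no curve kills an extreme weight part of \<open>f\<close>.\<close>
  define Q where "Q i w = (\<Sum>(a, b)\<in>supp f. if wt (a, b) = w then monom (coeff2 f a b * \<kappa> ^ (i * a) * \<mu> ^ (i * b)) b else 0)"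
    for i w
  have Q0: "Q i w \<noteq> 0" if wW: "w \<in> W" for i w
  proof -
    obtain a b where ab: "(a, b) \<in> supp f" "w = wt (a, b)" using wW by (auto simp: W_def)
    have inj: "a' = a" if "wt (a', b) = w" for a'
      using that ab(2) pq by (simp add: wt_def)
    have "coeff (Q i w) b = (\<Sum>(a', b')\<in>supp f. if a' = a \<and> b' = b then coeff2 f a' b' * \<kappa> ^ (i * a') * \<mu> ^ (i * b') else 0)"
      unfolding Q_def coeff_sum using inj ab(2) by (intro sum.cong refl) (auto split: if_splits)
    also have "\<dots> = coeff2 f a b * \<kappa> ^ (i * a) * \<mu> ^ (i * b)"
      by (simp add: sum_single_index[OF finite_supp] ab(1))
    also have "\<dots> \<noteq> 0" using nz ab(1) by (simp add: supp_def)
    finally show ?thesis by auto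
  qed
  have "finite (\<Union>i<p. {y. poly (Q i w0) y = 0} \<union> {y. poly (Q i w1) y = 0})"
    using Q0 w by (intro finite_UN_I finite_UnI poly_roots_finite) auto
  then obtain y where y: "y \<notin> (\<Union>i<p. {y. poly (Q i w0) y = 0} \<union> {y. poly (Q i w1) y = 0})"
    using ex_new_if_finite[OF infinite_UNIV_char_0] by blast

  define F where "F i = on_curve p q (\<kappa> ^ i) (\<mu> ^ i * y)" for i
  have F_nth: "F i h $$ n = (\<Sum>(a, b)\<in>supp h. if wt (a, b) = n then coeff2 h a b * y ^ b * (\<kappa> ^ a * \<mu> ^ b) ^ i else 0)"
    for i h n
    unfolding F_def on_curve_nth
    by (intro sum.cong refl) (auto simp: wt_def power_mult_distrib power_mult[symmetric] mult_ac)
  have F_Q: "F i f $$ w = poly (Q i w) y" for i w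
    unfolding F_nth Q_def poly_sum
    by (intro sum.cong refl) (auto simp: poly_monom power_mult_distrib power_mult[symmetric] mult_ac)
  have F_out: "F i f $$ n = 0" if "n < w0 \<or> n > w1" for i n
    unfolding F_nth using bounds that by (intro sum.neutral) fastforce
  have F_vanish: "(\<Sum>i<p. F i (f ^ m) $$ 0) = 0" if m: "m \<ge> 1" for m
  proof -
    have "(\<Sum>i<p. F i (f ^ m) $$ 0) = (\<Sum>(a, b)\<in>supp (f ^ m). if wt (a, b) = 0
        then coeff2 (f ^ m) a b * y ^ b * (\<Sum>i<p. (\<kappa> ^ a * \<mu> ^ b) ^ i) else 0)"
      unfolding F_nth by (subst sum.swap) (intro sum.cong refl, auto simp: sum_distrib_left)
    also have "\<dots> = 0"
    proof (intro sum.neutral ballI)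
      fix s assume "s \<in> supp (f ^ m)"
      obtain a b where s: "s = (a, b)" by (cases s)
      have "(\<kappa> ^ a * \<mu> ^ b) ^ p = 1" if "wt (a, b) = 0"
      proof -
        have "int (q * a) = int (p * b)" using that by (simp add: wt_def)
        then have "q * a = p * b" by (simp only: of_nat_eq_iff)
        then have "(\<kappa> ^ a * \<mu> ^ b) ^ p = \<kappa> ^ (p * a) * \<mu> ^ (q * a)"
          by (simp add: power_mult_distrib mult.commute flip: power_mult)
        also have "\<dots> = (\<kappa> ^ p * \<mu> ^ q) ^ a" by (simp add: power_mult_distrib power_mult)
        finally show ?thesis by (simp add: res)
      qed
      then show "(case s of (a, b) \<Rightarrow> if wt (a, b) = 0
          then coeff2 (f ^ m) a b * y ^ b * (\<Sum>i<p. (\<kappa> ^ a * \<mu> ^ b) ^ i) else 0) = 0"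
        using vanish[OF m, of a b] by (auto simp: s sum_powers_root_of_unity)
    qed
    finally show ?thesis .
  qed

  define r n where "r = nat (- w0)" and "n = nat (w1 - w0)"
  have r: "int r = - w0" and n: "int n = w1 - w0" using w0 w1 by (simp_all add: r_def n_def)
  define g where "g i = (\<Sum>k\<le>n. monom (F i f $$ (int k - int r)) k)" for i
  have g_coeff: "coeff (g i) k = F i f $$ (int k - int r)" for i k
  proof (cases "k \<le> n")
    case True
    then show ?thesis by (simp add: g_def coeff_sum)
  next
    case False
    then have "int k - int r > w1" using r n by simp
    then show ?thesis using False by (simp add: g_def coeff_sum F_out)
  qed
  have g_fls: "fps_to_fls (fps_of_poly (g i)) = fls_X ^ r * F i f" for i
  proof (rule fls_eqI)
    fix k
    show "fps_to_fls (fps_of_poly (g i)) $$ k = (fls_X ^ r * F i f) $$ k"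
      using r by (cases "k < 0") (simp_all add: fls_X_power_times_conv_shift g_coeff F_out)
  qed
  have "coeff (g i ^ m) (r * m) = F i (f ^ m) $$ 0" for i m
  proof -
    have "fps_to_fls (fps_of_poly (g i ^ m)) = fls_X ^ (r * m) * F i (f ^ m)"
      unfolding fps_of_poly_power fps_to_fls_power g_fls F_def OC.hom_power
      by (simp add: power_mult_distrib power_mult)
    then have "fps_to_fls (fps_of_poly (g i ^ m)) $$ int (r * m) = (fls_X ^ (r * m) * F i (f ^ m)) $$ int (r * m)"
      by (simp only:)
    moreover have "fps_to_fls (fps_of_poly (g i ^ m)) $$ int (r * m) = coeff (g i ^ m) (r * m)"
      by (simp del: of_nat_mult)
    moreover have "(fls_X ^ (r * m) * F i (f ^ m)) $$ int (r * m) = F i (f ^ m) $$ 0"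
      by (simp add: fls_X_power_times_conv_shift)
    ultimately show ?thesis by (simp only:)
  qed
  moreover have "\<exists>m\<ge>1. (\<Sum>i<p. coeff (g i ^ m) (r * m)) \<noteq> 0"
  proof (rule constant_terms_of_powers_nonzero[where n = n])
    show "r \<le> n" using r n w1 by simp
    fix i assume i: "i \<in> {..<p}"
    have "int 0 - int r = w0" "int n - int r = w1" using r n by simp_all
    then have "coeff (g i) 0 \<noteq> 0" "coeff (g i) n \<noteq> 0"
      using y i unfolding g_coeff by (auto simp: F_Q)
    moreover have "degree (g i) \<le> n"
      unfolding g_def by (rule degree_sum_le) (auto intro: order_trans[OF degree_monom_le])
    ultimately show "coeff (g i) 0 \<noteq> 0" "degree (g i) = n"
      by (auto intro: antisym le_degree)
  qed (use pq in \<open>auto simp: lessThan_empty_iff\<close>)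
  ultimately show False using F_vanish by auto
qed

lemma mathieu_zhao_jordan_block:
  fixes \<phi> :: "'k::field_char_0 poly poly \<Rightarrow> 'k poly poly"
  assumes "poly_endo \<phi>" "\<phi> X1 = const2 \<kappa> * X1" "\<phi> X2 = const2 \<kappa> * X2 + X1"
  shows "mathieu_zhao_space (im_diff \<phi>)"
proof (rule mathieu_zhao_im_diffI[OF assms(1)])
  fix f g assume "\<And>m. m \<ge> 1 \<Longrightarrow> f ^ m \<in> im_diff \<phi>"
  then have "coeff2 (f ^ m) 0 b = 0" if "m \<ge> 1" "\<kappa> ^ b = 1" for m b
    using that by (auto simp: im_diff_jordan_block[OF assms])
  then have "coeff2 (g * f ^ m) 0 b = 0" if "m \<ge> 1" "\<kappa> ^ b = 1" for m b
    using that by (rule resonance_on_axis)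
  then show "\<exists>N. \<forall>m\<ge>N. g * f ^ m \<in> im_diff \<phi>"
    by (intro exI[of _ 1]) (auto simp: im_diff_jordan_block[OF assms])
qed

lemma mathieu_zhao_diagonal_axis:
  fixes \<phi> :: "'k::field_char_0 poly poly \<Rightarrow> 'k poly poly"
  assumes \<phi>: "poly_endo \<phi>" "\<phi> X1 = const2 \<kappa> * X1" "\<phi> X2 = const2 \<mu> * X2"
    and axis: "\<And>a b. \<kappa> ^ a * \<mu> ^ b = 1 \<Longrightarrow> a = 0"
  shows "mathieu_zhao_space (im_diff \<phi>)"
proof (rule mathieu_zhao_im_diffI[OF \<phi>(1)])
  fix f g assume "\<And>m. m \<ge> 1 \<Longrightarrow> f ^ m \<in> im_diff \<phi>"
  then have "coeff2 (f ^ m) 0 b = 0" if "m \<ge> 1" "\<mu> ^ b = 1" for m b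
    using that unfolding im_diff_diagonal[OF \<phi>] by (metis (mono_tags, lifting) mem_Collect_eq mult_1 power_0)
  then have *: "coeff2 (g * f ^ m) 0 b = 0" if "m \<ge> 1" "\<mu> ^ b = 1" for m b
    using that by (rule resonance_on_axis)
  have "coeff2 (g * f ^ m) a b = 0" if "m \<ge> 1" "\<kappa> ^ a * \<mu> ^ b = 1" for m a b
    using * that axis[OF that(2)] by simp
  then show "\<exists>N. \<forall>m\<ge>N. g * f ^ m \<in> im_diff \<phi>"
    unfolding im_diff_diagonal[OF \<phi>] by blast
qed

text \<open>
  If \<open>\<mu>\<close> is a root of unity then so is \<open>\<kappa>\<close>, and averaging over a finite group gives \<open>f = 0\<close>.
  Otherwise all resonances have weight 0, while the weights of \<open>f\<close> are all positive or all negative.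
\<close>
lemma mathieu_zhao_diagonal_interior:
  fixes \<phi> :: "'k::{alg_closed_field,field_char_0} poly poly \<Rightarrow> 'k poly poly"
  assumes \<phi>: "poly_endo \<phi>" "\<phi> X1 = const2 \<kappa> * X1" "\<phi> X2 = const2 \<mu> * X2"
    and pq: "p \<ge> 1" "q \<ge> 1" and res: "\<kappa> ^ p * \<mu> ^ q = 1"
  shows "mathieu_zhao_space (im_diff \<phi>)"
proof (rule mathieu_zhao_im_diffI[OF \<phi>(1)])
  fix f g assume "\<And>m. m \<ge> 1 \<Longrightarrow> f ^ m \<in> im_diff \<phi>"
  then have vanish: "coeff2 (f ^ m) a b = 0" if "m \<ge> 1" "\<kappa> ^ a * \<mu> ^ b = 1" for m a b
    using that unfolding im_diff_diagonal[OF \<phi>] by blast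
  show "\<exists>N. \<forall>m\<ge>N. g * f ^ m \<in> im_diff \<phi>"
  proof (cases "\<exists>N\<ge>1. \<mu> ^ N = 1")
    case True
    then obtain N where N: "N \<ge> 1" "\<mu> ^ N = 1" by blast
    have "(\<kappa> ^ p * \<mu> ^ q) ^ N = \<kappa> ^ (p * N) * (\<mu> ^ N) ^ q"
      by (simp add: power_mult_distrib mult.commute flip: power_mult)
    then have roots: "\<kappa> ^ (p * N) = 1" "\<mu> ^ (p * N) = 1"
      using N(2) res by (simp_all add: power_mult mult.commute[of p])
    have "ev_at x y f = 0" for x y
    proof (rule ev_at_eq_0_of_twisted_power_sums[where N = "p * N" and \<kappa> = \<kappa> and \<mu> = \<mu>])
      show "p * N \<ge> 1" using pq(1) N(1) by simp
      fix m :: nat assume m: "m \<ge> 1"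
      have "(\<kappa> ^ a * \<mu> ^ b) ^ (p * N) = (\<kappa> ^ (p * N)) ^ a * (\<mu> ^ (p * N)) ^ b" for a b
        by (simp add: power_mult_distrib mult.commute flip: power_mult)
      then have "(\<kappa> ^ a * \<mu> ^ b) ^ (p * N) = 1" for a b by (simp add: roots)
      then show "(\<Sum>i<p * N. ev_at (\<kappa> ^ i * x) (\<mu> ^ i * y) (f ^ m)) = 0"
        using vanish[OF m] by (intro twisted_sum) auto
    qed
    then have "f = 0" by (rule ev_at_all_0_imp)
    then have "g * f ^ m \<in> im_diff \<phi>" if "m \<ge> 1" for m
      using that poly_endo.im_zero[OF \<phi>(1)] by (simp add: power_0_left)
    then show ?thesis by blast
  next
    case False
    have weight: "int q * int a = int p * int b" if ab: "\<kappa> ^ a * \<mu> ^ b = 1" for a b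
    proof -
      have "\<mu> \<noteq> 0" using res pq by (auto simp: power_0_left)
      have "\<kappa> ^ (p * a) * \<mu> ^ (p * b) = (\<kappa> ^ a * \<mu> ^ b) ^ p"
           "\<kappa> ^ (p * a) * \<mu> ^ (q * a) = (\<kappa> ^ p * \<mu> ^ q) ^ a"
        by (simp_all add: power_mult_distrib mult.commute flip: power_mult)
      then have eq: "\<kappa> ^ (p * a) * \<mu> ^ (p * b) = 1" "\<kappa> ^ (p * a) * \<mu> ^ (q * a) = 1"
        by (simp_all add: ab res)
      then have "\<kappa> ^ (p * a) * \<mu> ^ (p * b) = \<kappa> ^ (p * a) * \<mu> ^ (q * a)" by simp
      moreover have "\<kappa> ^ (p * a) \<noteq> 0" using eq by (metis mult_zero_left zero_neq_one)
      ultimately have \<mu>eq: "\<mu> ^ (p * b) = \<mu> ^ (q * a)" by (metis mult_left_cancel)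
      have no: "i = j" if "\<mu> ^ i = \<mu> ^ j" "i \<le> j" for i j
      proof (rule ccontr)
        assume "i \<noteq> j"
        have "\<mu> ^ j = \<mu> ^ i * \<mu> ^ (j - i)" using that(2) by (simp flip: power_add)
        then have "\<mu> ^ (j - i) = 1" using that(1) \<open>\<mu> \<noteq> 0\<close> by simp
        moreover have "j - i \<ge> 1" using \<open>i \<noteq> j\<close> that(2) by simp
        ultimately show False using False by blast
      qed
      have "q * a = p * b"
        using no[of "q * a" "p * b"] no[of "p * b" "q * a"] \<mu>eq by (metis nle_le)
      then show ?thesis by (simp flip: of_nat_mult)
    qed
    have "\<exists>u v. f \<in> weight_ge u v 1 \<and> (\<forall>a b. \<kappa> ^ a * \<mu> ^ b = 1 \<longrightarrow> u * int a + v * int b = 0)"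
      using definite_weight_of_no_resonance[OF pq res vanish] weight
      by (metis (no_types, opaque_lifting) add.commute add.right_inverse mult_minus_left)
    then obtain u v where uv: "f \<in> weight_ge u v 1"
      "\<And>a b. \<kappa> ^ a * \<mu> ^ b = 1 \<Longrightarrow> u * int a + v * int b = 0" by blast
    obtain N where "\<forall>m\<ge>N. g * f ^ m \<in> weight_ge u v 1"
      using positive_weight_eventually[OF uv(1)] by blast
    then have "\<forall>m\<ge>N. g * f ^ m \<in> im_diff \<phi>"
      unfolding im_diff_diagonal[OF \<phi>] weight_ge_def using uv(2) by force
    then show ?thesis by blast
  qed
qed

section \<open>Reduction to the normal forms\<close>
definition aff :: "'k::comm_ring_1 \<Rightarrow> 'k \<Rightarrow> 'k \<Rightarrow> 'k poly poly"
  where "aff a b c = const2 a * X1 + const2 b * X2 + const2 c"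

lemma aff_eqI: "a = a' \<Longrightarrow> b = b' \<Longrightarrow> c = c' \<Longrightarrow> aff a b c = aff a' b' c'"
  by simp

lemma aff_simps:
  "aff a b c + aff a' b' c' = aff (a + a') (b + b') (c + c')"
  "const2 k * aff a b c = aff (k * a) (k * b) (k * c)"
  "aff a b c + const2 k = aff a b (c + k)"
  by (simp_all add: aff_def K2.hom_add K2.hom_mult algebra_simps)

lemma X_aff: "X1 = aff 1 0 0" "X2 = aff 0 1 0"
  by (simp_all add: aff_def K2.hom_zero K2.hom_one)

lemma (in poly_endo) hom_aff: "\<phi> (aff a b c) = const2 a * \<phi> X1 + const2 b * \<phi> X2 + const2 c"
  by (simp add: aff_def hom_add hom_mult fixes_const)

text \<open>
  The new coordinates are \<open>aff s t e\<close> and \<open>aff s' t' e'\<close>; the two displayed identities express that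
  \<open>\<phi>\<close> acts on them as \<open>\<psi>\<close> acts on \<open>x\<^sub>1\<close> and \<open>x\<^sub>2\<close>.
\<close>
lemma mathieu_zhao_affine_conjugate:
  fixes \<phi> :: "'k::field poly poly \<Rightarrow> 'k poly poly"
  assumes \<phi>: "poly_endo \<phi>" "\<phi> X1 = aff a b c" "\<phi> X2 = aff a' b' c'"
    and det: "s * t' - t * s' \<noteq> 0"
    and u: "const2 s * aff a b c + const2 t * aff a' b' c' + const2 e
      = const2 p * aff s t e + const2 q * aff s' t' e' + const2 w"
    and v: "const2 s' * aff a b c + const2 t' * aff a' b' c' + const2 e'
      = const2 p' * aff s t e + const2 q' * aff s' t' e' + const2 w'"
    and mz: "\<And>\<psi>. poly_endo \<psi> \<Longrightarrow> \<psi> X1 = aff p q w \<Longrightarrow> \<psi> X2 = aff p' q' w' \<Longrightarrow> mathieu_zhao_space (im_diff \<psi>)"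
  shows "mathieu_zhao_space (im_diff \<phi>)"
proof -
  define D where "D = s * t' - t * s'"
  have D: "D \<noteq> 0" using det by (simp add: D_def)
  define \<sigma> where "\<sigma> = K2.ev2 (aff s t e) (aff s' t' e')"
  define \<tau> where "\<tau> = K2.ev2 (aff (t' / D) (- t / D) ((t * e' - t' * e) / D)) (aff (- s' / D) (s / D) ((s' * e - s * e') / D))"
  define \<psi> where "\<psi> = K2.ev2 (aff p q w) (aff p' q' w')"
  have endo: "poly_endo \<sigma>" "poly_endo \<tau>" "poly_endo \<psi>"
    unfolding \<sigma>_def \<tau>_def \<psi>_def by (rule poly_endo_subst)+
  interpret S: poly_endo \<sigma> by fact
  interpret T: poly_endo \<tau> by fact
  interpret F: poly_endo \<phi> by fact
  have \<sigma>: "\<sigma> X1 = aff s t e" "\<sigma> X2 = aff s' t' e'"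
    by (simp_all add: \<sigma>_def K2.ev2_X1 K2.ev2_X2)
  have \<tau>: "\<tau> X1 = aff (t' / D) (- t / D) ((t * e' - t' * e) / D)"
     "\<tau> X2 = aff (- s' / D) (s / D) ((s' * e - s * e') / D)"
    by (simp_all add: \<tau>_def K2.ev2_X1 K2.ev2_X2)
  have \<psi>: "\<psi> X1 = aff p q w" "\<psi> X2 = aff p' q' w'"
    by (simp_all add: \<psi>_def K2.ev2_X1 K2.ev2_X2)
  have "\<sigma> (\<tau> X1) = aff 1 0 0"
    unfolding \<tau> S.hom_aff \<sigma> aff_simps
    by (rule aff_eqI; use D in \<open>simp add: field_simps\<close>; simp add: D_def algebra_simps)
  moreover have "\<sigma> (\<tau> X2) = aff 0 1 0"
    unfolding \<tau> S.hom_aff \<sigma> aff_simps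
    by (rule aff_eqI; use D in \<open>simp add: field_simps\<close>; simp add: D_def algebra_simps)
  moreover have "\<tau> (\<sigma> X1) = aff 1 0 0"
    unfolding \<sigma> T.hom_aff \<tau> aff_simps
    by (rule aff_eqI; use D in \<open>simp add: field_simps\<close>; simp add: D_def algebra_simps)
  moreover have "\<tau> (\<sigma> X2) = aff 0 1 0"
    unfolding \<sigma> T.hom_aff \<tau> aff_simps
    by (rule aff_eqI; use D in \<open>simp add: field_simps\<close>; simp add: D_def algebra_simps)
  moreover have "\<phi> (\<sigma> X1) = \<sigma> (\<psi> X1)" "\<phi> (\<sigma> X2) = \<sigma> (\<psi> X2)"
    unfolding \<sigma> \<psi> F.hom_aff S.hom_aff \<phi> by (rule u, rule v)
  ultimately show ?thesis
    using mathieu_zhao_conjugate[OF \<phi>(1) endo(3,1,2) _ _ _ _ _ _ mz[OF endo(3) \<psi>]] by (simp flip: X_aff)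
qed

lemma mathieu_zhao_UNIV: "mathieu_zhao_space (UNIV :: 'k::field poly poly set)"
proof -
  interpret vector_space "scale2 :: 'k \<Rightarrow> _" by (rule vector_space_scale2)
  show ?thesis by (simp add: mathieu_zhao_space_def subspace_UNIV)
qed

text \<open>
  If no resonance has both exponents positive, then all resonances lie on one axis, since a nontrivial
  one on each axis would give a product with both exponents positive. Exchanging the variables
  makes it the axis \<open>x\<^sub>1 = 0\<close>.
\<close>
lemma mathieu_zhao_diagonal:
  fixes \<phi> :: "'k::{alg_closed_field,field_char_0} poly poly \<Rightarrow> 'k poly poly"
  assumes \<phi>: "poly_endo \<phi>" "\<phi> X1 = aff \<kappa> 0 0" "\<phi> X2 = aff 0 \<mu> 0"
  shows "mathieu_zhao_space (im_diff \<phi>)"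
proof -
  have diag: "\<psi> X1 = const2 x * X1" "\<psi> X2 = const2 y * X2"
    if "\<psi> X1 = aff x 0 0" "\<psi> X2 = aff 0 y 0" for \<psi> :: "'k poly poly \<Rightarrow> 'k poly poly" and x y
    using that by (simp_all add: aff_def const2_def)
  consider p q where "p \<ge> 1" "q \<ge> 1" "\<kappa> ^ p * \<mu> ^ q = 1"
    | "\<And>a b. \<kappa> ^ a * \<mu> ^ b = 1 \<Longrightarrow> a = 0" | "\<And>a b. \<kappa> ^ a * \<mu> ^ b = 1 \<Longrightarrow> b = 0"
  proof (cases "\<exists>p\<ge>1. \<exists>q\<ge>1. \<kappa> ^ p * \<mu> ^ q = 1")
    case False
    have "a = 0 \<or> b = 0" if "\<kappa> ^ a * \<mu> ^ j = 1" "\<kappa> ^ i * \<mu> ^ b = 1" for a b i j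
    proof (rule ccontr)
      assume "\<not> (a = 0 \<or> b = 0)"
      moreover have "\<kappa> ^ (a + i) * \<mu> ^ (j + b) = 1"
      proof -
        have "\<kappa> ^ (a + i) * \<mu> ^ (j + b) = (\<kappa> ^ a * \<mu> ^ j) * (\<kappa> ^ i * \<mu> ^ b)"
          by (simp only: power_add mult_ac)
        then show ?thesis by (simp add: that)
      qed
      ultimately show False using False by (metis One_nat_def Suc_leI add_gr_0 neq0_conv)
    qed
    then show ?thesis using that(2,3) by blast
  qed (use that(1) in blast)
  then show ?thesis
  proof cases
    case 1
    then show ?thesis by (rule mathieu_zhao_diagonal_interior[OF \<phi>(1) diag[OF \<phi>(2,3)]])
  next
    case 2
    then show ?thesis by (rule mathieu_zhao_diagonal_axis[OF \<phi>(1) diag[OF \<phi>(2,3)]])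
  next
    case 3
    show ?thesis
    proof (rule mathieu_zhao_affine_conjugate[OF \<phi>, where s = 0 and t = 1 and e = 0 and s' = 1 and t' = 0 and e' = 0
        and p = \<mu> and q = 0 and w = 0 and p' = 0 and q' = \<kappa> and w' = 0])
      fix \<psi> :: "'k poly poly \<Rightarrow> 'k poly poly"
      assume "poly_endo \<psi>" "\<psi> X1 = aff \<mu> 0 0" "\<psi> X2 = aff 0 \<kappa> 0"
      moreover have "a = 0" if "\<mu> ^ a * \<kappa> ^ b = 1" for a b
        using 3[of b a] that by (simp add: mult.commute)
      ultimately show "mathieu_zhao_space (im_diff \<psi>)"
        using mathieu_zhao_diagonal_axis diag by blast
    qed (simp_all add: aff_simps)
  qed
qed

lemma mathieu_zhao_translation:
  fixes \<phi> :: "'k::field_char_0 poly poly \<Rightarrow> 'k poly poly"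
  assumes "poly_endo \<phi>" "\<phi> X1 = aff 1 0 w" "\<phi> X2 = aff \<epsilon> \<mu> w'" "w \<noteq> 0"
  shows "mathieu_zhao_space (im_diff \<phi>)"
proof -
  have "\<phi> X1 = X1 + const2 w" "\<phi> X2 = const2 \<mu> * X2 + const2 \<epsilon> * X1 + const2 w'"
    using assms(2,3) by (simp_all add: aff_def K2.hom_zero K2.hom_one)
  then show ?thesis
    using im_diff_translation[OF assms(1,4)] mathieu_zhao_UNIV by simp
qed

text \<open>
  Unless \<open>\<kappa> = 1\<close> and \<open>w \<noteq> 0\<close>, a shift by \<open>e\<close> makes the first coordinate an eigenvector. The matrix
  is diagonalised by \<open>k\<close> if possible; the second coordinate is then a translation or can be
  made an eigenvector as well. Otherwise the matrix is a Jordan block, and scaling and shifting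
  the first coordinate absorbs \<open>\<epsilon>\<close> and the constant in the second one.
\<close>
lemma mathieu_zhao_triangular:
  fixes \<phi> :: "'k::{alg_closed_field,field_char_0} poly poly \<Rightarrow> 'k poly poly"
  assumes \<phi>: "poly_endo \<phi>" "\<phi> X1 = aff \<kappa> 0 w" "\<phi> X2 = aff \<epsilon> \<mu> w'"
  shows "mathieu_zhao_space (im_diff \<phi>)"
proof (cases "\<kappa> = 1 \<and> w \<noteq> 0")
  case True
  then show ?thesis using mathieu_zhao_translation \<phi> by blast
next
  case False
  define e where "e = w / (\<kappa> - 1)"
  have e: "w + e = \<kappa> * e" using False by (auto simp: e_def field_simps)
  show ?thesis
  proof (cases "\<kappa> \<noteq> \<mu> \<or> \<epsilon> = 0")
    case True
    define k where "k = \<epsilon> / (\<mu> - \<kappa>)"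
    have k: "k * \<kappa> + \<epsilon> = \<mu> * k" using True by (auto simp: k_def field_simps)
    define W where "W = k * w + w'"
    show ?thesis
    proof (cases "\<mu> = 1 \<and> W \<noteq> 0")
      case True
      show ?thesis
      proof (rule mathieu_zhao_affine_conjugate[OF \<phi>, where s = k and t = 1 and e = 0 and s' = 1 and t' = 0 and e' = e
          and p = 1 and q = 0 and w = W and p' = 0 and q' = \<kappa> and w' = 0])
        show "mathieu_zhao_space (im_diff \<psi>)" if "poly_endo \<psi>" "\<psi> X1 = aff 1 0 W" "\<psi> X2 = aff 0 \<kappa> 0" for \<psi>
          using mathieu_zhao_translation that True by blast
      qed (use True k e in \<open>simp_all add: aff_simps W_def\<close>)
    next
      case False
      define e' where "e' = W / (\<mu> - 1)"
      have e': "k * w + w' + e' = \<mu> * e'" unfolding W_def[symmetric]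
      proof (cases "\<mu> = 1")
        case True
        then show "W + e' = \<mu> * e'" using False by simp
      next
        case ne: False
        then have "(\<mu> - 1) * e' = W" by (simp add: e'_def)
        then show "W + e' = \<mu> * e'" by (simp add: algebra_simps)
      qed
      show ?thesis
      proof (rule mathieu_zhao_affine_conjugate[OF \<phi>, where s = 1 and t = 0 and e = e and s' = k and t' = 1 and e' = e'
          and p = \<kappa> and q = 0 and w = 0 and p' = 0 and q' = \<mu> and w' = 0])
        show "mathieu_zhao_space (im_diff \<psi>)" if "poly_endo \<psi>" "\<psi> X1 = aff \<kappa> 0 0" "\<psi> X2 = aff 0 \<mu> 0" for \<psi>
          using mathieu_zhao_diagonal that by blast
      qed (use k e e' in \<open>simp_all add: aff_simps\<close>)
    qed
  next
    case F: False
    have block: "mathieu_zhao_space (im_diff \<psi>)"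
      if "poly_endo \<psi>" "\<psi> X1 = aff \<kappa> 0 0" "\<psi> X2 = aff 1 \<kappa> 0" for \<psi>
      using that by (intro mathieu_zhao_jordan_block[of \<psi> \<kappa>]) (simp_all add: aff_def K2.hom_zero K2.hom_one)
    show ?thesis
    proof (cases "\<kappa> = 1")
      case True
      then show ?thesis
        by (intro mathieu_zhao_affine_conjugate[OF \<phi>, where s = \<epsilon> and t = 0 and e = w' and s' = 0 and t' = 1 and e' = 0
          and p = \<kappa> and q = 0 and w = 0 and p' = 1 and q' = \<kappa> and w' = 0] block)
          (use F False in \<open>simp_all add: aff_simps\<close>)
    next
      case ne: False
      define e' where "e' = (w' - \<epsilon> * e) / (\<kappa> - 1)"
      have e': "w' + e' = \<epsilon> * e + \<kappa> * e'" using ne by (simp add: e'_def field_simps)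
      have "\<epsilon> * w + \<epsilon> * e = \<kappa> * (\<epsilon> * e)"
        using e by (simp add: algebra_simps flip: distrib_left)
      then show ?thesis
        by (intro mathieu_zhao_affine_conjugate[OF \<phi>, where s = \<epsilon> and t = 0 and e = "\<epsilon> * e" and s' = 0 and t' = 1 and e' = e'
          and p = \<kappa> and q = 0 and w = 0 and p' = 1 and q' = \<kappa> and w' = 0] block)
          (use F e' in \<open>simp_all add: aff_simps mult.commute\<close>)
    qed
  qed
qed

lemma eigenvector_2x2:
  fixes a b a' b' :: "'k::alg_closed_field"
  shows "\<exists>s t \<kappa>. (s \<noteq> 0 \<or> t \<noteq> 0) \<and> s * a + t * a' = \<kappa> * s \<and> s * b + t * b' = \<kappa> * t"
proof -
  have "\<exists>\<kappa>. poly [:a * b' - b * a', - (a + b'), 1:] \<kappa> = 0"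
    by (rule alg_closed_imp_poly_has_root) simp
  then obtain \<kappa> where \<kappa>: "a * b' - b * a' = \<kappa> * (a + b') - \<kappa> * \<kappa>"
    by (auto simp: algebra_simps eq_neg_iff_add_eq_0)
  consider "a' \<noteq> 0 \<or> \<kappa> \<noteq> a" | "a' = 0" "\<kappa> = a" "b \<noteq> 0 \<or> \<kappa> \<noteq> b'" | "a' = 0" "\<kappa> = a" "b = 0" "\<kappa> = b'"
    by blast
  then show ?thesis
  proof cases
    case 1
    then show ?thesis using \<kappa>
      by (intro exI[of _ a'] exI[of _ "\<kappa> - a"] exI[of _ \<kappa>]) (auto simp: algebra_simps)
  next
    case 2
    then show ?thesis
      by (intro exI[of _ "\<kappa> - b'"] exI[of _ b] exI[of _ \<kappa>]) (auto simp: algebra_simps)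
  next
    case 3
    then show ?thesis by (intro exI[of _ 1] exI[of _ 0] exI[of _ \<kappa>]) auto
  qed
qed

lemma mathieu_zhao_affine:
  fixes \<phi> :: "'k::{alg_closed_field,field_char_0} poly poly \<Rightarrow> 'k poly poly"
  assumes \<phi>: "poly_endo \<phi>" "\<phi> X1 = aff a b c" "\<phi> X2 = aff a' b' c'"
  shows "mathieu_zhao_space (im_diff \<phi>)"
proof -
  obtain s t \<kappa> where st: "s \<noteq> 0 \<or> t \<noteq> 0" "s * a + t * a' = \<kappa> * s" "s * b + t * b' = \<kappa> * t"
    using eigenvector_2x2[of a a' b b'] by blast
  show ?thesis
  proof (cases "s = 0")
    case True
    show ?thesis
      by (rule mathieu_zhao_affine_conjugate[OF \<phi>, where s = s and t = t and e = 0 and s' = 1 and t' = 0 and e' = 0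
          and p = \<kappa> and q = 0 and w = "s * c + t * c'" and p' = "b / t" and q' = a and w' = c])
        (use True st in \<open>simp_all add: aff_simps mathieu_zhao_triangular mult.commute\<close>)
  next
    case False
    show ?thesis
      by (rule mathieu_zhao_affine_conjugate[OF \<phi>, where s = s and t = t and e = 0 and s' = 0 and t' = 1 and e' = 0
          and p = \<kappa> and q = 0 and w = "s * c + t * c'" and p' = "a' / s" and q' = "b' - a' * t / s" and w' = c'])
        (use False st in \<open>simp_all add: aff_simps mathieu_zhao_triangular\<close>)
  qed
qed

theorem proposition3p4:
  fixes \<phi> \<delta> :: "'k::{alg_closed_field, field_char_0} poly poly \<Rightarrow> 'k poly poly"
  assumes "affine_polynomial_hom \<phi>"
    and "\<delta> = (\<lambda>p. p - \<phi> p)"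
  shows "mathieu_zhao_space (range \<delta>)"
proof -
  obtain A :: "'k^2^2" and c :: "'k^2" where eq: "(vector [\<phi> X1, \<phi> X2] :: 'k poly poly^2) =
      map_matrix const2 A *v vector [X1, X2] + vec_lambda (\<lambda>i. const2 (vec_nth c i))"
    using assms(1) by (auto simp: affine_polynomial_hom_def)
  have "poly_endo \<phi>"
    using assms(1) by (simp add: affine_polynomial_hom_def algebra_endomorphism_imp_poly_endo)
  moreover have "\<phi> X1 = aff (vec_nth (vec_nth A 1) 1) (vec_nth (vec_nth A 1) 2) (vec_nth c 1)"
    "\<phi> X2 = aff (vec_nth (vec_nth A 2) 1) (vec_nth (vec_nth A 2) 2) (vec_nth c 2)"
    using eq by (simp_all add: vec_eq_iff forall_2 matrix_vector_mult_def sum_2 aff_def)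
  ultimately show ?thesis
    using mathieu_zhao_affine by (simp add: assms(2) im_diff_def[symmetric])
qed

end
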